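(* There exists a strictly positive function $\delta(\alpha,\tau)$ defined for $\alpha,\tau\in(0,1)$ with the following property: for all sufficiently large $n$, for every $\alpha\in(0,1)$, for every $\tau\in(0,1)$, for $\beta=\alpha+\delta(\alpha,\tau)$, and for every binary string $x$ of length $n$ such that $\mathrm{C}(x)\ge\alpha n$, the probability of the event $$\mathrm{C}(N_\tau(x))>\beta n$$ is at least $1-\frac1n$.
   Context: $\mathrm{C}(x)$ denotes the plain Kolmogorov complexity of the binary string $x$: the minimal length of a program that generates $x$, with respect to a fixed optimal programming language (one that makes the complexity function minimal up to an additive $O(1)$ term). For $\tau\in(0,1)$ and a binary string $x$ of length $n$, $N_\tau(x)$ is the random string obtained from $x$ by changing each bit of $x$ independently with probability $\tau$; the probability in the claim is over this random noise.
   Formalization: "For all sufficiently large n" is read after "for every α, for every τ": how large n must be may depend on α and τ (not on x), because a threshold uniform in τ fails, e.g. for x=0^n or 1^n, α=C(x)/n and τ so small that the noise leaves x unchanged with probability above 1/n. *)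

theory Defs
  imports "HOL-Probability.Probability" "HOL-Library.Nat_Bijection"
begin

(* Unbounded minimisation: the search on k diverges at the first k where f is undefined. *)
definition minimization :: "(nat \<rightharpoonup> nat) \<Rightarrow> nat \<rightharpoonup> nat" where
  "minimization f a =
     (if \<exists>k. f (prod_encode (a, k)) = Some 0 \<and> (\<forall>j<k. f (prod_encode (a, j)) \<noteq> None)
      then Some (LEAST k. f (prod_encode (a, k)) = Some 0)
      else None)"

(* Kleene's partial recursive functions, presented as unary functions: several arguments are
   passed through the pairing bijection prod_encode, so that the projections and pairing replace
   n-ary projections and n-ary composition. *)
inductive partial_recursive :: "(nat \<rightharpoonup> nat) \<Rightarrow> bool" where
  zero: "partial_recursive (\<lambda>n. Some 0)"
| succ: "partial_recursive (\<lambda>n. Some (Suc n))"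
| left: "partial_recursive (\<lambda>n. Some (fst (prod_decode n)))"
| right: "partial_recursive (\<lambda>n. Some (snd (prod_decode n)))"
| pair: "partial_recursive f \<Longrightarrow> partial_recursive g \<Longrightarrow>
    partial_recursive (\<lambda>n. Option.bind (f n) (\<lambda>a. Option.bind (g n) (\<lambda>b. Some (prod_encode (a, b)))))"
| comp: "partial_recursive f \<Longrightarrow> partial_recursive g \<Longrightarrow>
    partial_recursive (f \<circ>\<^sub>m g)"
| prim_rec: "partial_recursive f \<Longrightarrow> partial_recursive g \<Longrightarrow>
    partial_recursive (\<lambda>n. case prod_decode n of (a, k) \<Rightarrow>
      rec_nat (f a) (\<lambda>m r. Option.bind r (\<lambda>b. g (prod_encode (a, prod_encode (m, b))))) k)"
| mu: "partial_recursive f \<Longrightarrow> partial_recursive (minimization f)"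

(* Bijective base-2 numeration, a bijection between binary strings and natural numbers. *)
primrec string_code :: "bool list \<Rightarrow> nat" where
  "string_code [] = 0"
| "string_code (b # bs) = 2 * string_code bs + (if b then 2 else 1)"

definition computable :: "(bool list \<rightharpoonup> bool list) \<Rightarrow> bool" where
  "computable V \<longleftrightarrow>
     (\<exists>g. partial_recursive g \<and> (\<forall>p. g (string_code p) = map_option string_code (V p)))"

(* A programming language is a partial computable map from programs to outputs. The complexity
   is infinite for a string that no program generates. *)
definition complexity :: "(bool list \<rightharpoonup> bool list) \<Rightarrow> bool list \<Rightarrow> enat" where
  "complexity V x = (INF p\<in>{p. V p = Some x}. enat (length p))"

definition optimal :: "(bool list \<rightharpoonup> bool list) \<Rightarrow> bool" where
  "optimal U \<longleftrightarrow> computable U \<and>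
     (\<forall>V. computable V \<longrightarrow> (\<exists>c::nat. \<forall>x. complexity U x \<le> complexity V x + enat c))"

primrec noise :: "real \<Rightarrow> bool list \<Rightarrow> bool list pmf" where
  "noise \<tau> [] = return_pmf []"
| "noise \<tau> (b # bs) = do {
     flip \<leftarrow> bernoulli_pmf \<tau>;
     ys \<leftarrow> noise \<tau> bs;
     return_pmf ((if flip then \<not> b else b) # ys) }"

end

(* Let B be the set of the at most 2^(m+1) strings y with C(y) \<le> m, where m = \<lfloor>\<beta>n\<rfloor>, and suppose that
   N_\<tau>(x) falls into B with probability more than 1/n. Splitting B by the Hamming distance from x,
   one finds a distance k such that the sphere of radius k around x contains at least 2^t points of B
   and 2^t \<tau>^k (1-\<tau>)^(n-k) \<ge> 1/(2n(n+1)). The set A of all strings with at least 2^t points of B at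
   distance k is enumerable from (n,k,t,m), so C(x) \<le> log |A| + O(log n); unlike the condition on the
   probability, this condition does not involve the possibly non-computable \<tau>.

   All points of A are moved into B with probability at least \<epsilon> = 1/(2n(n+1)). With \<rho> = 1-2\<tau> and
   p = 1+\<rho>^2, hypercontractivity of the noise operator from L_p to L_2 bounds the uniform measure \<mu> by
   \<epsilon> \<mu>(A)^(1/2) \<le> \<mu>(B)^(1/p). Hence log |A| \<le> n(1-(2/p)(1-\<beta>)) + O(log n), and since 2/p > 1 this
   is smaller than \<alpha>n by a linear term if \<beta> = \<alpha> + (1-\<alpha>)\<tau>(1-\<tau>). *)

theory Submission
  imports Defs "HOL-Real_Asymp.Real_Asymp"
begin

section \<open>Total recursive functions\<close>

definition total_recursive :: "(nat \<Rightarrow> nat) \<Rightarrow> bool" where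
  "total_recursive f \<longleftrightarrow> partial_recursive (\<lambda>n. Some (f n))"

definition decidable :: "(nat \<Rightarrow> bool) \<Rightarrow> bool" where
  "decidable P \<longleftrightarrow> total_recursive (\<lambda>n. of_bool (P n))"

abbreviation "pfst z \<equiv> fst (prod_decode z)"
abbreviation "psnd z \<equiv> snd (prod_decode z)"

named_theorems recursive_intros

lemma total_recursive_comp:
  assumes "total_recursive f" "total_recursive g"
  shows "total_recursive (\<lambda>z. f (g z))"
  using partial_recursive.comp[OF assms[unfolded total_recursive_def]]
  by (simp add: total_recursive_def map_comp_def)

lemma total_recursive_pfst [recursive_intros]:
  "total_recursive f \<Longrightarrow> total_recursive (\<lambda>z. pfst (f z))"
  by (rule total_recursive_comp[of "\<lambda>z. pfst z"])
     (simp_all add: total_recursive_def partial_recursive.left)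

lemma total_recursive_psnd [recursive_intros]:
  "total_recursive f \<Longrightarrow> total_recursive (\<lambda>z. psnd (f z))"
  by (rule total_recursive_comp[of "\<lambda>z. psnd z"])
     (simp_all add: total_recursive_def partial_recursive.right)

lemma total_recursive_Suc [recursive_intros]:
  "total_recursive f \<Longrightarrow> total_recursive (\<lambda>z. Suc (f z))"
  by (rule total_recursive_comp[of Suc]) (simp_all add: total_recursive_def partial_recursive.succ)

lemma total_recursive_pair [recursive_intros]:
  assumes "total_recursive f" "total_recursive g"
  shows "total_recursive (\<lambda>z. prod_encode (f z, g z))"
  using partial_recursive.pair[OF assms[unfolded total_recursive_def]]
  by (simp add: total_recursive_def)

text \<open>The identity is not a basic function, but it pairs the two projections of its
  argument.\<close>

lemma total_recursive_id [recursive_intros]: "total_recursive (\<lambda>z. z)"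
  using total_recursive_pair[of "\<lambda>z. pfst z" "\<lambda>z. psnd z"]
  by (simp add: total_recursive_def partial_recursive.left partial_recursive.right)

lemma total_recursive_const [recursive_intros]: "total_recursive (\<lambda>z. c)"
proof (induction c)
  case 0
  show ?case by (simp add: total_recursive_def partial_recursive.zero)
next
  case (Suc c)
  then show ?case by (rule total_recursive_Suc)
qed

text \<open>Functions of several arguments are first proved recursive on coded tuples; substitution
  then feeds them arbitrary recursive arguments.\<close>

lemma total_recursive_subst2:
  assumes "total_recursive (\<lambda>w. F (pfst w) (psnd w))" "total_recursive a" "total_recursive b"
  shows "total_recursive (\<lambda>z. F (a z) (b z))"
  using total_recursive_comp[OF assms(1) total_recursive_pair[OF assms(2,3)]] by simp

lemma total_recursive_subst3:
  assumes "total_recursive (\<lambda>w. F (pfst w) (pfst (psnd w)) (psnd (psnd w)))"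
    and "total_recursive a" "total_recursive b" "total_recursive c"
  shows "total_recursive (\<lambda>z. F (a z) (b z) (c z))"
  using total_recursive_comp[OF assms(1) total_recursive_pair[OF assms(2) total_recursive_pair[OF assms(3,4)]]]
  by simp

lemma decidable_subst3:
  assumes "decidable (\<lambda>w. R (pfst w) (pfst (psnd w)) (psnd (psnd w)))"
    and "total_recursive a" "total_recursive b" "total_recursive c"
  shows "decidable (\<lambda>z. R (a z) (b z) (c z))"
  using total_recursive_subst3[where F = "\<lambda>a b c. of_bool (R a b c)"] assms
  unfolding decidable_def by blast

text \<open>With total \<open>f\<close> and \<open>g\<close> the option recursion of
  \<open>prim_rec\<close> never meets \<open>None\<close> and collapses to \<open>rec_nat\<close>.
  The whole input \<open>z\<close> serves as the parameter, so the step may depend on it.\<close>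

lemma total_recursive_rec [recursive_intros]:
  assumes f: "total_recursive f"
    and g: "total_recursive (\<lambda>w. g (pfst w) (pfst (psnd w)) (psnd (psnd w)))"
    and k: "total_recursive k"
  shows "total_recursive (\<lambda>z. rec_nat (f z) (\<lambda>m b. g z m b) (k z))"
proof -
  have *: "rec_nat (Some u) (\<lambda>m r. Option.bind r (\<lambda>b. Some (h m b))) k = Some (rec_nat u h k)"
    for u :: nat and h k
    by (induction k) auto
  have "total_recursive (\<lambda>z. rec_nat (f (pfst z)) (\<lambda>m b. g (pfst z) m b) (psnd z))"
    using partial_recursive.prim_rec[OF f[unfolded total_recursive_def] g[unfolded total_recursive_def]]
    by (simp add: total_recursive_def case_prod_unfold *)
  from total_recursive_comp[OF this total_recursive_pair[OF total_recursive_id k]]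
  show ?thesis by simp
qed

section \<open>Arithmetic and bounded sums\<close>

lemma total_recursive_add [recursive_intros]:
  assumes "total_recursive f" "total_recursive g"
  shows "total_recursive (\<lambda>z. f z + g z)"
proof -
  have *: "u + k = rec_nat u (\<lambda>m b. Suc b) k" for u k :: nat
    by (induction k) auto
  show ?thesis
    unfolding * by (intro recursive_intros assms)
qed

lemma total_recursive_mult [recursive_intros]:
  assumes "total_recursive f" "total_recursive g"
  shows "total_recursive (\<lambda>z. f z * g z)"
proof -
  have *: "u * k = rec_nat 0 (\<lambda>m b. b + u) k" for u k :: nat
    by (induction k) auto
  show ?thesis
    unfolding * by (intro recursive_intros assms total_recursive_comp[OF assms(1)])
qed

lemma total_recursive_power [recursive_intros]:
  assumes "total_recursive f" "total_recursive g"
  shows "total_recursive (\<lambda>z. f z ^ g z)"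
proof -
  have *: "u ^ k = rec_nat 1 (\<lambda>m b. b * u) k" for u k :: nat
    by (induction k) auto
  show ?thesis
    unfolding * by (intro recursive_intros assms total_recursive_comp[OF assms(1)])
qed

lemma total_recursive_diff [recursive_intros]:
  assumes "total_recursive f" "total_recursive g"
  shows "total_recursive (\<lambda>z. f z - g z)"
proof -
  \<comment> \<open>The predecessor is a recursion that returns its counter; iterating it gives
    truncated subtraction, which later decides comparisons.\<close>
  have pred: "k - 1 = rec_nat 0 (\<lambda>m b. m) k" for k :: nat
    by (cases k) auto
  have *: "u - k = rec_nat u (\<lambda>m b. rec_nat 0 (\<lambda>m b. m) b) k" for u k :: nat
    by (induction k) (auto simp flip: pred)
  show ?thesis
    unfolding * by (intro recursive_intros assms)
qed

lemma total_recursive_sum [recursive_intros]: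
  assumes h: "total_recursive (\<lambda>w. h (pfst w) (psnd w))" and b: "total_recursive b"
  shows "total_recursive (\<lambda>z. \<Sum>j<b z. h z j)"
proof -
  have *: "(\<Sum>j<k. h z j) = rec_nat 0 (\<lambda>m r. r + h z m) k" for z k
    by (induction k) auto
  show ?thesis
    unfolding * by (intro recursive_intros b total_recursive_subst2[OF h])
qed

section \<open>Decidable predicates, bounded quantifiers and division\<close>

lemma total_recursive_of_bool [recursive_intros]:
  "decidable P \<Longrightarrow> total_recursive (\<lambda>z. of_bool (P z))"
  by (simp add: decidable_def)

lemma decidable_not [recursive_intros]:
  assumes "decidable P"
  shows "decidable (\<lambda>z. \<not> P z)"
proof -
  have *: "of_bool (\<not> P z) = 1 - (of_bool (P z) :: nat)" for z
    by simp
  show ?thesis unfolding decidable_def * by (intro recursive_intros assms)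
qed

lemma decidable_conj [recursive_intros]:
  assumes "decidable P" "decidable Q"
  shows "decidable (\<lambda>z. P z \<and> Q z)"
  unfolding decidable_def of_bool_conj by (intro recursive_intros assms)

lemma decidable_le [recursive_intros]:
  assumes "total_recursive f" "total_recursive g"
  shows "decidable (\<lambda>z. f z \<le> g z)"
proof -
  have *: "of_bool (f z \<le> g z) = 1 - (f z - g z)" for z
    by simp
  show ?thesis unfolding decidable_def * by (intro recursive_intros assms)
qed

lemma decidable_less [recursive_intros]:
  assumes "total_recursive f" "total_recursive g"
  shows "decidable (\<lambda>z. f z < g z)"
  unfolding less_eq_Suc_le by (intro recursive_intros assms)

lemma decidable_eq [recursive_intros]:
  assumes "total_recursive f" "total_recursive g"
  shows "decidable (\<lambda>z. f z = g z)"
  unfolding order_eq_iff by (intro recursive_intros assms)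

lemma decidable_bex [recursive_intros]:
  assumes "decidable (\<lambda>w. P (pfst w) (psnd w))" "total_recursive b"
  shows "decidable (\<lambda>z. \<exists>j<b z. P z j)"
proof -
  have *: "(\<exists>j<b z. P z j) \<longleftrightarrow> 0 < (\<Sum>j<b z. of_bool (P z j) :: nat)" for z
    by (auto simp: sum_eq_0_iff zero_less_iff_neq_zero)
  show ?thesis unfolding * by (intro recursive_intros assms)
qed

lemma decidable_ball [recursive_intros]:
  assumes "decidable (\<lambda>w. P (pfst w) (psnd w))" "total_recursive b"
  shows "decidable (\<lambda>z. \<forall>j<b z. P z j)"
proof -
  have *: "(\<forall>j<b z. P z j) \<longleftrightarrow> \<not> (\<exists>j<b z. \<not> P z j)" for z
    by blast
  show ?thesis unfolding * by (intro recursive_intros assms)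
qed

lemma total_recursive_if [recursive_intros]:
  assumes "decidable P" "total_recursive f" "total_recursive g"
  shows "total_recursive (\<lambda>z. if P z then f z else g z)"
proof -
  have *: "(if P z then f z else g z) = of_bool (P z) * f z + of_bool (\<not> P z) * g z" for z
    by simp
  show ?thesis unfolding * by (intro recursive_intros assms)
qed

lemma sum_of_bool_eq_card: "(\<Sum>i<n. of_bool (P i) :: nat) = card {i. i < n \<and> P i}" for n :: nat
  by (simp add: of_bool_def sum.If_cases lessThan_def Int_def)

text \<open>The quotient counts the positive multiples of the divisor up to the dividend. The
  condition \<open>0 < v\<close> makes the count 0 for a zero divisor, in accordance with
  HOL.\<close>

lemma total_recursive_div [recursive_intros]:
  assumes "total_recursive f" "total_recursive g"
  shows "total_recursive (\<lambda>z. f z div g z)"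
proof -
  have *: "u div v = (\<Sum>j<u. of_bool (0 < v \<and> Suc j * v \<le> u))" for u v :: nat
  proof (cases "v = 0")
    case False
    then have "Suc j * v \<le> u \<longleftrightarrow> j < u div v" for j
      by (metis Suc_le_eq less_eq_div_iff_mult_less_eq neq0_conv)
    then have "{j. j < u \<and> Suc j * v \<le> u} = {..<u div v}"
      by (auto intro: less_le_trans[OF _ div_le_dividend])
    then have "u div v = card {j. j < u \<and> Suc j * v \<le> u}" by simp
    also have "\<dots> = (\<Sum>j<u. of_bool (Suc j * v \<le> u))"
      by (rule sum_of_bool_eq_card[symmetric])
    finally show ?thesis using False by simp
  qed simp
  show ?thesis
    by (subst *) (intro recursive_intros assms total_recursive_comp[OF assms(1)] total_recursive_comp[OF assms(2)])
qed

lemma total_recursive_mod [recursive_intros]: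
  assumes "total_recursive f" "total_recursive g"
  shows "total_recursive (\<lambda>z. f z mod g z)"
  unfolding modulo_nat_def by (intro recursive_intros assms)

section \<open>Computable approximations of partial recursive functions\<close>

text \<open>Shifting defined values by one frees 0 for an unfinished computation, so that
  step-bounded partial functions can be handled as total ones.\<close>

definition opt_code :: "nat option \<Rightarrow> nat" where
  "opt_code r = (case r of None \<Rightarrow> 0 | Some b \<Rightarrow> Suc b)"

lemma opt_code_simps [simp]: "opt_code None = 0" "opt_code (Some b) = Suc b"
  by (simp_all add: opt_code_def)

lemma opt_code_eq_Suc [simp]: "opt_code r = Suc b \<longleftrightarrow> r = Some b"
  by (cases r) auto

lemma opt_code_bind:
  "opt_code (Option.bind r h) = (if opt_code r = 0 then 0 else opt_code (h (opt_code r - 1)))"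
  by (cases r) auto

lemma total_recursive_bind [recursive_intros]:
  assumes "total_recursive (\<lambda>z. opt_code (r z))"
    and "total_recursive (\<lambda>w. opt_code (h (pfst w) (psnd w)))"
  shows "total_recursive (\<lambda>z. opt_code (Option.bind (r z) (h z)))"
  unfolding opt_code_bind
  by (intro recursive_intros assms(1) total_recursive_subst2[OF assms(2)])

lemma total_recursive_Some [recursive_intros]:
  "total_recursive f \<Longrightarrow> total_recursive (\<lambda>z. opt_code (Some (f z)))"
  unfolding opt_code_simps by (rule total_recursive_Suc)

text \<open>\<open>F a s\<close> is the result of running \<open>f\<close> on \<open>a\<close> for at most \<open>s\<close> steps.\<close>

definition approximates :: "(nat \<Rightarrow> nat \<Rightarrow> nat option) \<Rightarrow> (nat \<rightharpoonup> nat) \<Rightarrow> bool" where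
  "approximates F f \<longleftrightarrow>
     total_recursive (\<lambda>w. opt_code (F (pfst w) (psnd w))) \<and>
     (\<forall>a s t b. F a s = Some b \<longrightarrow> s \<le> t \<longrightarrow> F a t = Some b) \<and>
     (\<forall>a b. f a = Some b \<longleftrightarrow> (\<exists>s. F a s = Some b))"

lemma approximatesI:
  assumes "total_recursive (\<lambda>w. opt_code (F (pfst w) (psnd w)))"
    and "\<And>a s t b. F a s = Some b \<Longrightarrow> s \<le> t \<Longrightarrow> F a t = Some b"
    and "\<And>a s b. F a s = Some b \<Longrightarrow> f a = Some b"
    and "\<And>a b. f a = Some b \<Longrightarrow> \<exists>s. F a s = Some b"
  shows "approximates F f"
  using assms unfolding approximates_def by blast

lemma approximates_total_recursive:
  "approximates F f \<Longrightarrow> total_recursive a \<Longrightarrow> total_recursive b \<Longrightarrow>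
    total_recursive (\<lambda>z. opt_code (F (a z) (b z)))"
  unfolding approximates_def by (blast intro: total_recursive_subst2[where F = "\<lambda>a b. opt_code (F a b)"])

lemma approximates_mono: "approximates F f \<Longrightarrow> F a s = Some b \<Longrightarrow> s \<le> t \<Longrightarrow> F a t = Some b"
  unfolding approximates_def by blast

lemma approximates_iff: "approximates F f \<Longrightarrow> f a = Some b \<longleftrightarrow> (\<exists>s. F a s = Some b)"
  unfolding approximates_def by blast

lemma approximates_total:
  "total_recursive f \<Longrightarrow> approximates (\<lambda>a s. Some (f a)) (\<lambda>a. Some (f a))"
  by (rule approximatesI) (auto intro: total_recursive_Some total_recursive_comp[OF _ total_recursive_pfst[OF total_recursive_id]]
      simp del: opt_code_simps)

lemma approximates_pair:
  assumes F: "approximates F f" and G: "approximates G g"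
  shows "approximates
    (\<lambda>n s. Option.bind (F n s) (\<lambda>a. Option.bind (G n s) (\<lambda>b. Some (prod_encode (a, b)))))
    (\<lambda>n. Option.bind (f n) (\<lambda>a. Option.bind (g n) (\<lambda>b. Some (prod_encode (a, b)))))"
    (is "approximates ?H ?h")
proof (rule approximatesI)
  show "total_recursive (\<lambda>w. opt_code (Option.bind (F (pfst w) (psnd w))
    (\<lambda>a. Option.bind (G (pfst w) (psnd w)) (\<lambda>b. Some (prod_encode (a, b))))))"
    by (intro recursive_intros assms[THEN approximates_total_recursive])
next
  fix n c
  assume "Option.bind (f n) (\<lambda>a. Option.bind (g n) (\<lambda>b. Some (prod_encode (a, b)))) = Some c"
  then obtain a b s t where "F n s = Some a" "G n t = Some b" "c = prod_encode (a, b)"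
    unfolding bind_eq_Some_conv approximates_iff[OF F] approximates_iff[OF G] by blast
  \<comment> \<open>Results persist under larger budgets, so two budgets merge into their
    maximum.\<close>
  then have "F n (max s t) = Some a" "G n (max s t) = Some b" "c = prod_encode (a, b)"
    using approximates_mono[OF F] approximates_mono[OF G] by (meson max.cobounded1 max.cobounded2)+
  then show "\<exists>s. Option.bind (F n s) (\<lambda>a. Option.bind (G n s) (\<lambda>b. Some (prod_encode (a, b)))) = Some c"
    by (intro exI[of _ "max s t"]) auto
next
  fix n s t c
  assume "?H n s = Some c" "s \<le> t"
  then show "?H n t = Some c"
    using approximates_mono[OF F] approximates_mono[OF G] unfolding bind_eq_Some_conv by blast
next
  fix n s c
  assume "?H n s = Some c"
  then show "?h n = Some c"
    using approximates_iff[OF F] approximates_iff[OF G] unfolding bind_eq_Some_conv by blast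
qed

lemma approximates_comp:
  assumes F: "approximates F f" and G: "approximates G g"
  shows "approximates (\<lambda>n s. Option.bind (G n s) (\<lambda>v. F v s)) (f \<circ>\<^sub>m g)"
proof (rule approximatesI)
  show "total_recursive (\<lambda>w. opt_code (Option.bind (G (pfst w) (psnd w)) (\<lambda>v. F v (psnd w))))"
    by (intro recursive_intros F[THEN approximates_total_recursive] G[THEN approximates_total_recursive])
next
  fix n c
  assume "(f \<circ>\<^sub>m g) n = Some c"
  then obtain v s t where "G n s = Some v" "F v t = Some c"
    unfolding map_comp_Some_iff approximates_iff[OF F] approximates_iff[OF G] by blast
  then have "G n (max s t) = Some v" "F v (max s t) = Some c"
    using approximates_mono[OF F] approximates_mono[OF G] by (meson max.cobounded1 max.cobounded2)+
  then show "\<exists>s. Option.bind (G n s) (\<lambda>v. F v s) = Some c"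
    by (intro exI[of _ "max s t"]) auto
next
  fix n s t c
  assume "Option.bind (G n s) (\<lambda>v. F v s) = Some c" "s \<le> t"
  then show "Option.bind (G n t) (\<lambda>v. F v t) = Some c"
    using approximates_mono[OF F] approximates_mono[OF G] unfolding bind_eq_Some_conv by blast
next
  fix n s c
  assume "Option.bind (G n s) (\<lambda>v. F v s) = Some c"
  then show "(f \<circ>\<^sub>m g) n = Some c"
    using approximates_iff[OF F] approximates_iff[OF G] unfolding bind_eq_Some_conv map_comp_Some_iff by blast
qed

text \<open>All stages of the recursion run under the same budget; conversely, induction on the
  depth merges the budgets that the single stages need.\<close>

lemma approximates_prim_rec:
  assumes F: "approximates F f" and G: "approximates G g"
  shows "approximates
    (\<lambda>n s. rec_nat (F (pfst n) s)
      (\<lambda>m r. Option.bind r (\<lambda>b. G (prod_encode (pfst n, prod_encode (m, b))) s)) (psnd n))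
    (\<lambda>n. case prod_decode n of (a, k) \<Rightarrow>
      rec_nat (f a) (\<lambda>m r. Option.bind r (\<lambda>b. g (prod_encode (a, prod_encode (m, b))))) k)"
    (is "approximates (\<lambda>n s. ?R (pfst n) s (psnd n)) _")
proof (rule approximatesI)
  \<comment> \<open>On codes, the option recursion becomes a recursion on numbers in which 0
    propagates.\<close>
  have *: "opt_code (?R a s k) = rec_nat (opt_code (F a s)) (\<lambda>m c. if c = 0 then 0 else
      opt_code (G (prod_encode (a, prod_encode (m, c - 1))) s)) k" for a s k
    by (induction k) (auto simp: opt_code_bind)
  show "total_recursive (\<lambda>w. opt_code (?R (pfst (pfst w)) (psnd w) (psnd (pfst w))))"
    unfolding *
    by (intro recursive_intros F[THEN approximates_total_recursive] G[THEN approximates_total_recursive])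
next
  have mono: "?R a s k = Some b \<Longrightarrow> s \<le> t \<Longrightarrow> ?R a t k = Some b" for a s t k b
  proof (induction k arbitrary: b)
    case (Suc k)
    then show ?case
      using approximates_mono[OF G] unfolding nat.rec bind_eq_Some_conv by blast
  next
    case 0
    then show ?case
      using approximates_mono[OF F] unfolding nat.rec by blast
  qed
  then show "?R (pfst n) s (psnd n) = Some b \<Longrightarrow> s \<le> t \<Longrightarrow> ?R (pfst n) t (psnd n) = Some b" for n s t b
    by blast
  let ?r = "\<lambda>a k. rec_nat (f a) (\<lambda>m r. Option.bind r (\<lambda>b. g (prod_encode (a, prod_encode (m, b))))) k"
  have "?R a s k = Some b \<Longrightarrow> ?r a k = Some b" for a s k b
  proof (induction k arbitrary: b)
    case (Suc k)
    then show ?case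
      using approximates_iff[OF G] unfolding nat.rec bind_eq_Some_conv by blast
  next
    case 0
    then show ?case
      using approximates_iff[OF F] unfolding nat.rec by blast
  qed
  then show "?R (pfst n) s (psnd n) = Some b \<Longrightarrow> (case prod_decode n of (a, k) \<Rightarrow> ?r a k) = Some b" for n s b
    by (auto simp: case_prod_unfold)
  have "?r a k = Some b \<Longrightarrow> \<exists>s. ?R a s k = Some b" for a k b
  proof (induction k arbitrary: b)
    case (Suc k)
    then obtain v s t where "?R a s k = Some v" "G (prod_encode (a, prod_encode (k, v))) t = Some b"
      using approximates_iff[OF G] unfolding nat.rec bind_eq_Some_conv by blast
    then have "?R a (max s t) k = Some v" "G (prod_encode (a, prod_encode (k, v))) (max s t) = Some b"
      using approximates_mono[OF G] mono by (meson max.cobounded1 max.cobounded2)+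
    then show ?case by (intro exI[of _ "max s t"]) auto
  next
    case 0
    then show ?case
      using approximates_iff[OF F] unfolding nat.rec by blast
  qed
  then show "(case prod_decode n of (a, k) \<Rightarrow> ?r a k) = Some b \<Longrightarrow> \<exists>s. ?R (pfst n) s (psnd n) = Some b" for n b
    by (auto simp: case_prod_unfold)
qed

text \<open>A witness \<open>k\<close> of the definition bounds the least zero from above, so all
  values below that zero are defined, and by minimality they are nonzero.\<close>

lemma minimization_eq_Some_iff:
  "minimization f a = Some b \<longleftrightarrow>
    f (prod_encode (a, b)) = Some 0 \<and> (\<forall>j<b. \<exists>v. f (prod_encode (a, j)) = Some (Suc v))"
  (is "_ \<longleftrightarrow> ?Q b")
proof
  let ?P = "\<lambda>k. f (prod_encode (a, k)) = Some 0"
  assume "minimization f a = Some b"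
  then obtain k where k: "?P k" "\<forall>j<k. f (prod_encode (a, j)) \<noteq> None" and b: "b = (LEAST k. ?P k)"
    by (auto simp: minimization_def split: if_splits)
  have "b \<le> k" "?P b" using k(1) unfolding b by (auto intro: Least_le LeastI)
  moreover have "\<not> ?P j" if "j < b" for j using that not_less_Least unfolding b by blast
  ultimately show "?Q b"
    using k(2) by (metis (no_types, opaque_lifting) not0_implies_Suc not_None_eq order_less_le_trans)
next
  assume Q: "?Q b"
  then have "(LEAST k. f (prod_encode (a, k)) = Some 0) = b"
    by (intro Least_equality) (blast, metis Zero_not_Suc not_le_imp_less option.inject)
  then show "minimization f a = Some b"
    using Q unfolding minimization_def by (metis option.distinct(1))
qed

text \<open>With budget \<open>s\<close> the search tries only candidates below \<open>s\<close> and
  accepts one if it and all smaller ones are settled within \<open>s\<close> steps; at most one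
  candidate is accepted.\<close>

lemma approximates_minimization:
  assumes F: "approximates F f"
  shows "\<exists>G. approximates G (minimization f)"
proof -
  define Q where "Q a s k \<longleftrightarrow> F (prod_encode (a, k)) s = Some 0 \<and>
    (\<forall>j<k. \<exists>v. F (prod_encode (a, j)) s = Some (Suc v))" for a s k
  define G where "G a s = (if \<exists>k<s. Q a s k then Some (THE k. Q a s k) else None)" for a s
  have Q_unique: "k = k'" if "Q a s k" "Q a s k'" for a s k k'
    using that unfolding Q_def by (metis Zero_not_Suc linorder_neqE_nat option.inject)
  have Q_mono: "Q a t k" if "Q a s k" "s \<le> t" for a s t k
    using that unfolding Q_def by (meson approximates_mono[OF F])
  have G_iff: "G a s = Some k \<longleftrightarrow> k < s \<and> Q a s k" for a s k
    unfolding G_def using Q_unique theI[of "Q a s"] by (auto, blast+)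
  have "approximates G (minimization f)"
  proof (rule approximatesI)
    have Q_code: "Q a s k \<longleftrightarrow> opt_code (F (prod_encode (a, k)) s) = 1 \<and>
        (\<forall>j<k. 1 < opt_code (F (prod_encode (a, j)) s))" for a s k
      proof -
      have 1: "r = Some 0 \<longleftrightarrow> opt_code r = 1" and 2: "(\<exists>v. r = Some (Suc v)) \<longleftrightarrow> 1 < opt_code r" for r
        by (cases r; auto simp: gr0_conv_Suc)+
      show ?thesis unfolding Q_def 1[symmetric] 2[symmetric] ..
    qed
    \<comment> \<open>By uniqueness at most one summand is nonzero, so a bounded sum computes what
      \<open>THE\<close> selects.\<close>
    have "opt_code (G a s) = (\<Sum>k<s. if Q a s k then Suc k else 0)" for a s
    proof (cases "\<exists>k<s. Q a s k")
      case True
      then obtain k where k: "k < s" "Q a s k" by blast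
      then have "(\<Sum>k<s. if Q a s k then Suc k else 0) = (\<Sum>j<s. if j = k then Suc j else 0)"
        by (intro sum.cong) (auto dest: Q_unique)
      then show ?thesis using k G_iff[of a s k] by simp
    qed (auto simp: G_def)
    then show "total_recursive (\<lambda>w. opt_code (G (pfst w) (psnd w)))"
      unfolding Q_code by (simp only:) (intro recursive_intros F[THEN approximates_total_recursive])
  next
    fix a s t b
    assume "G a s = Some b" "s \<le> t"
    then show "G a t = Some b" unfolding G_iff using Q_mono by (meson less_le_trans)
  next
    fix a s b
    assume "G a s = Some b"
    then show "minimization f a = Some b"
      unfolding G_iff Q_def minimization_eq_Some_iff by (metis approximates_iff[OF F])
  next
    fix a b
    assume "minimization f a = Some b"
    then have *: "f (prod_encode (a, b)) = Some 0" "\<forall>j<b. \<exists>v. f (prod_encode (a, j)) = Some (Suc v)"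
      unfolding minimization_eq_Some_iff by blast+
    \<comment> \<open>Finitely many values precede \<open>b\<close>; induction collects one budget
      for all of them.\<close>
    have "\<exists>s. \<forall>j<k. \<exists>v. F (prod_encode (a, j)) s = Some (Suc v)" if "k \<le> b" for k
      using that
    proof (induction k)
      case (Suc k)
      then obtain s where s: "\<forall>j<k. \<exists>v. F (prod_encode (a, j)) s = Some (Suc v)" by auto
      obtain t v where t: "F (prod_encode (a, k)) t = Some (Suc v)"
        using *(2) Suc.prems approximates_iff[OF F] by (metis Suc_le_lessD)
      have "\<forall>j<Suc k. \<exists>v. F (prod_encode (a, j)) (max s t) = Some (Suc v)"
        using s t by (metis approximates_mono[OF F] less_Suc_eq max.cobounded1 max.cobounded2)
      then show ?case by blast
    qed auto
    then obtain s where s: "\<forall>j<b. \<exists>v. F (prod_encode (a, j)) s = Some (Suc v)" by blast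
    obtain t where t: "F (prod_encode (a, b)) t = Some 0"
      using *(1) approximates_iff[OF F] by blast
    have "Q a (max s t) b"
      using s t unfolding Q_def by (meson approximates_mono[OF F] max.cobounded1 max.cobounded2)
    \<comment> \<open>The budget must also exceed \<open>b\<close>, since only candidates below it
      are tried.\<close>
    then have "G a (max (max s t) (Suc b)) = Some b"
      unfolding G_iff by (auto intro: Q_mono)
    then show "\<exists>s. G a s = Some b" by blast
  qed
  then show ?thesis by blast
qed

text \<open>Takes the place of a step-counting universal machine: each single partial recursive
  function gets its own bounded simulation, built along its derivation.\<close>

lemma partial_recursive_approximation:
  assumes "partial_recursive f"
  shows "\<exists>F. approximates F f"
  using assms
proof induction
  case (pair f g)
  then show ?case using approximates_pair by blast
next
  case (comp f g)
  then show ?case using approximates_comp by blast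
next
  case (prim_rec f g)
  then show ?case using approximates_prim_rec by blast
next
  case (mu f)
  then show ?case using approximates_minimization by blast
qed (use approximates_total in \<open>blast intro: total_recursive_id total_recursive_const total_recursive_Suc
      total_recursive_pfst total_recursive_psnd\<close>)+

section \<open>Complexity of the elements of an enumerable set\<close>

text \<open>The binary digits of \<open>Suc (string_code x)\<close> are a leading 1 above the bits
  of \<open>x\<close>, the head being least significant.\<close>

lemma string_code_bounds: "2 ^ length x \<le> Suc (string_code x)" "Suc (string_code x) < 2 ^ Suc (length x)"
  by (induction x) auto

lemma length_eq_iff_string_code:
  "length x = n \<longleftrightarrow> 2 ^ n \<le> Suc (string_code x) \<and> Suc (string_code x) < 2 ^ Suc n"
proof
  assume *: "2 ^ n \<le> Suc (string_code x) \<and> Suc (string_code x) < 2 ^ Suc n"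
  then have "(2::nat) ^ n < 2 ^ Suc (length x)" "(2::nat) ^ length x < 2 ^ Suc n"
    using string_code_bounds[of x] by linarith+
  then show "length x = n" by (simp only: power_strict_increasing_iff)
qed (use string_code_bounds[of x] in auto)

text \<open>The codes of the strings up to a given length form an initial segment of the naturals,
  so a search through short programs is a bounded quantifier.\<close>

lemma length_le_iff_string_code: "length x \<le> m \<longleftrightarrow> string_code x < 2 ^ Suc m - 1"
proof
  assume "length x \<le> m"
  then have "(2::nat) ^ Suc (length x) \<le> 2 ^ Suc m" by (intro power_increasing) auto
  then show "string_code x < 2 ^ Suc m - 1" using string_code_bounds(2)[of x] by linarith
next
  assume "string_code x < 2 ^ Suc m - 1"
  then have "(2::nat) ^ length x < 2 ^ Suc m" using string_code_bounds(1)[of x] by linarith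
  then show "length x \<le> m" by (simp only: power_strict_increasing_iff)
qed

lemma inj_string_code: "inj string_code"
proof (rule injI)
  show "string_code x = string_code y \<Longrightarrow> x = y" for x y
  proof (induction x arbitrary: y)
    case Nil
    then show ?case by (cases y) (auto split: if_splits)
  next
    case (Cons a x)
    then obtain b y' where y: "y = b # y'" by (cases y) (auto split: if_splits)
    have "a = b \<and> string_code x = string_code y'"
      using Cons.prems unfolding y by (auto split: if_splits) presburger+
    then show ?case using Cons.IH y by blast
  qed
qed

lemma surj_string_code: "surj string_code"
proof -
  have "\<exists>x. string_code x = n" for n
  proof (induction n rule: less_induct)
    case (less n)
    show ?case
    proof (cases "n = 0")
      case True
      then show ?thesis by (metis string_code.simps(1))
    next
      case False
      then obtain x where "string_code x = (n - 1) div 2" using less by force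
      then have "string_code (even n # x) = n" using False by (cases "even n"; simp; presburger)
      then show ?thesis by blast
    qed
  qed
  then show ?thesis by (metis surjI)
qed

lemma string_code_inv [simp]: "string_code (inv string_code n) = n"
  by (rule surj_f_inv_f[OF surj_string_code])

text \<open>The strict bound \<open>Suc m\<close> makes the infimum yield an actual program; a
  string without programs has infinite complexity and satisfies neither side.\<close>

lemma complexity_le_iff: "complexity U x \<le> enat m \<longleftrightarrow> (\<exists>p. length p \<le> m \<and> U p = Some x)"
proof -
  have "complexity U x \<le> enat m \<longleftrightarrow> complexity U x < enat (Suc m)"
    by (cases "complexity U x") auto
  also have "\<dots> \<longleftrightarrow> (\<exists>p. length p \<le> m \<and> U p = Some x)"
    unfolding complexity_def INF_less_iff by (auto simp: less_Suc_eq_le)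
  finally show ?thesis .
qed

text \<open>A program \<open>2 ^ l * (2 * (i * 2 ^ l + q) + 1)\<close> encodes the parameter \<open>q < 2 ^ l\<close> and the index
  \<open>i\<close> at a cost of only \<open>2 * l\<close> bits above the length of \<open>i\<close>, because \<open>l\<close> is the 2-adic valuation.\<close>

definition code_valuation :: "nat \<Rightarrow> nat" where
  "code_valuation c = (\<Sum>j<c. of_bool (c mod 2 ^ Suc j = 0))"

definition code_parameter :: "nat \<Rightarrow> nat" where
  "code_parameter c = c div 2 ^ Suc (code_valuation c) mod 2 ^ code_valuation c"

definition code_index :: "nat \<Rightarrow> nat" where
  "code_index c = c div 2 ^ Suc (code_valuation c) div 2 ^ code_valuation c"

lemma code_valuation_eq: "code_valuation (2 ^ l * (2 * w + 1)) = l"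
proof -
  let ?c = "2 ^ l * (2 * w + 1) :: nat"
  have "(2 :: nat) ^ Suc j dvd ?c \<longleftrightarrow> j < l" for j
  proof
    assume *: "2 ^ Suc j dvd ?c"
    show "j < l"
    proof (rule ccontr)
      assume "\<not> j < l"
      then have "(2 :: nat) ^ Suc l dvd 2 ^ Suc j" by (intro le_imp_power_dvd) simp
      then have "2 ^ l * 2 dvd ?c" using * by (metis dvd_trans power_Suc2)
      then have "2 dvd 2 * w + 1" by (subst (asm) dvd_times_left_cancel_iff) auto
      then show False by simp
    qed
  next
    assume "j < l"
    then show "2 ^ Suc j dvd ?c" by (intro dvd_mult2 le_imp_power_dvd) simp
  qed
  then have "code_valuation ?c = (\<Sum>j<?c. of_bool (j < l))"
    unfolding code_valuation_def by (simp only: dvd_eq_mod_eq_0[symmetric])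
  also have "\<dots> = card {j. j < ?c \<and> j < l}"
    by (rule sum_of_bool_eq_card)
  also have "{j. j < ?c \<and> j < l} = {..<l}"
  proof -
    \<comment> \<open>The defining sum ranges far enough: it ends at the number itself, which
      exceeds its valuation.\<close>
    have "l < 2 ^ l" by simp
    also have "\<dots> \<le> ?c" by simp
    finally show ?thesis by auto
  qed
  finally show ?thesis by simp
qed

lemma code_parameter_eq: "q < 2 ^ l \<Longrightarrow> code_parameter (2 ^ l * (2 * (i * 2 ^ l + q) + 1)) = q"
  and code_index_eq: "q < 2 ^ l \<Longrightarrow> code_index (2 ^ l * (2 * (i * 2 ^ l + q) + 1)) = i"
proof -
  have *: "2 ^ l * (2 * w + 1) div 2 ^ Suc l = w" for w :: nat
    by (simp only: power_Suc2 div_mult2_eq) simp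
  then show "q < 2 ^ l \<Longrightarrow> code_parameter (2 ^ l * (2 * (i * 2 ^ l + q) + 1)) = q"
    "q < 2 ^ l \<Longrightarrow> code_index (2 ^ l * (2 * (i * 2 ^ l + q) + 1)) = i"
    unfolding code_parameter_def code_index_def code_valuation_eq * by simp_all
qed

lemma total_recursive_code_valuation [recursive_intros]:
  "total_recursive f \<Longrightarrow> total_recursive (\<lambda>z. code_valuation (f z))"
  unfolding code_valuation_def
  by (rule total_recursive_comp[of "\<lambda>c. \<Sum>j<c. of_bool (c mod 2 ^ Suc j = 0)"]) (intro recursive_intros)

lemma total_recursive_code_parameter [recursive_intros]:
  "total_recursive f \<Longrightarrow> total_recursive (\<lambda>z. code_parameter (f z))"
  unfolding code_parameter_def by (intro recursive_intros)

lemma total_recursive_code_index [recursive_intros]: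
  "total_recursive f \<Longrightarrow> total_recursive (\<lambda>z. code_index (f z))"
  unfolding code_index_def by (intro recursive_intros)

text \<open>The parameter \<open>q\<close> and the rank of \<open>x\<close> in the order of
  enumeration determine \<open>x\<close>. The rank takes \<open>d\<close> bits by the cardinality
  bound; the enumeration procedure enters only through \<open>c\<close>, chosen before
  \<open>q\<close>, \<open>l\<close>, \<open>d\<close> and \<open>x\<close>.\<close>

lemma complexity_enumerable:
  assumes U: "optimal U"
    and R: "decidable (\<lambda>w. R (pfst w) (pfst (psnd w)) (psnd (psnd w)))"
  shows "\<exists>c. \<forall>q l d x. q < 2 ^ l \<longrightarrow> finite {a. \<exists>s. R q a s} \<longrightarrow> card {a. \<exists>s. R q a s} \<le> 2 ^ d \<longrightarrow>
    (\<exists>s. R q (string_code x) s) \<longrightarrow> complexity U x \<le> enat (2 * l + d + c)"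
proof -
  \<comment> \<open>\<open>new q e\<close>: the pair coded by \<open>e\<close> consists of an element and the first stage at which it appears.\<close>
  define new where "new q e \<longleftrightarrow> R q (pfst e) (psnd e) \<and> (\<forall>s<psnd e. \<not> R q (pfst e) s)" for q e
  define rank where "rank q e = (\<Sum>e'<e. of_bool (new q e') :: nat)" for q e
  \<comment> \<open>Zero stands for success here, because minimization searches for a zero.\<close>
  define h where "h w = (of_bool (\<not> (new (code_parameter (pfst w)) (psnd w) \<and>
    rank (code_parameter (pfst w)) (psnd w) = code_index (pfst w))) :: nat)" for w
  have "total_recursive h"
    unfolding h_def[abs_def] rank_def new_def
    by (intro recursive_intros decidable_subst3[OF R])
  define g where "g = (\<lambda>e. Some (pfst e)) \<circ>\<^sub>m minimization (\<lambda>w. Some (h w))"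
  have "partial_recursive g"
    unfolding g_def using \<open>total_recursive h\<close>
    by (intro partial_recursive.intros) (simp add: total_recursive_def)
  define V where "V p = map_option (inv string_code) (g (string_code p))" for p
  have "computable V"
    unfolding computable_def V_def using \<open>partial_recursive g\<close>
    by (intro exI[of _ g]) (simp add: option.map_comp comp_def option.map_ident)
  then obtain c where c: "complexity U x \<le> complexity V x + enat c" for x
    using U unfolding optimal_def by blast
  \<comment> \<open>The additional 1 pays for the marker bit between the zeros that encode
    \<open>l\<close> and the payload of the program.\<close>
  have "complexity U x \<le> enat (2 * l + d + (c + 1))"
    if q: "q < 2 ^ l" and fin: "finite {a. \<exists>s. R q a s}" and card: "card {a. \<exists>s. R q a s} \<le> 2 ^ d"
      and x: "\<exists>s. R q (string_code x) s" for q l d x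
  proof -
    define s where "s = (LEAST s. R q (string_code x) s)"
    define e where "e = prod_encode (string_code x, s)"
    have "R q (string_code x) s" unfolding s_def using x by (rule LeastI_ex)
    moreover have "\<not> R q (string_code x) s'" if "s' < s" for s'
      using that not_less_Least unfolding s_def by blast
    ultimately have "new q e" by (simp add: new_def e_def)
    define i where "i = rank q e"
    \<comment> \<open>Counting \<open>e\<close> itself gives \<open>i + 1\<close> new pairs, whose
      first components are distinct elements of the enumerated set.\<close>
    have "i + 1 = (\<Sum>e'<Suc e. of_bool (new q e'))"
      unfolding i_def rank_def using \<open>new q e\<close> by simp
    also have "\<dots> = card {e'. e' < Suc e \<and> new q e'}"
      by (rule sum_of_bool_eq_card)
    also have "\<dots> \<le> card {a. \<exists>s. R q a s}"
    proof (rule card_inj_on_le[OF _ _ fin])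
      have "e1 = e2" if "new q e1" "new q e2" "pfst e1 = pfst e2" for e1 e2
      proof -
        have "psnd e1 = psnd e2"
          using that unfolding new_def by (metis linorder_neqE_nat)
        then show ?thesis using that(3) by (metis prod_decode_eq prod_eqI)
      qed
      then show "inj_on (\<lambda>e. pfst e) {e'. e' < Suc e \<and> new q e'}"
        by (auto intro!: inj_onI)
      show "(\<lambda>e. pfst e) ` {e'. e' < Suc e \<and> new q e'} \<subseteq> {a. \<exists>s. R q a s}"
        unfolding new_def by blast
    qed
    finally have "i + 1 \<le> 2 ^ d" using card by linarith
    define w where "w = 2 ^ l * (2 * (i * 2 ^ l + q) + 1)"
    have par: "code_parameter w = q" and ind: "code_index w = i"
      unfolding w_def using code_parameter_eq[OF q] code_index_eq[OF q] by blast+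
    \<comment> \<open>Ranks strictly increase along new pairs, so the search cannot stop before
      \<open>e\<close>.\<close>
    have "\<not> (new q j \<and> rank q j = i)" if "j < e" for j
    proof
      assume *: "new q j \<and> rank q j = i"
      have "rank q j + 1 = (\<Sum>e'<Suc j. of_bool (new q e'))"
        unfolding rank_def using * by simp
      also have "\<dots> \<le> rank q e"
        unfolding rank_def using that by (intro sum_mono2) auto
      finally show False using * unfolding i_def by simp
    qed
    then have "minimization (\<lambda>w. Some (h w)) w = Some e"
      unfolding minimization_eq_Some_iff h_def using \<open>new q e\<close> by (simp add: par ind i_def)
    then have "g w = Some (string_code x)"
      by (simp add: g_def map_comp_def e_def)
    then have "V (inv string_code w) = Some x"
      by (simp add: V_def inv_f_f[OF inj_string_code])
    then have "complexity V x \<le> enat (length (inv string_code w))"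
      using complexity_le_iff by blast
    moreover have "length (inv string_code w) \<le> 2 * l + d + 1"
    proof -
      have double_less: "a < b \<Longrightarrow> 2 * a + 1 < 2 * b" for a b :: nat by simp
      have "i * 2 ^ l + q + 1 \<le> (i + 1) * 2 ^ l" using q by simp
      also have "\<dots> \<le> 2 ^ d * 2 ^ l" using \<open>i + 1 \<le> 2 ^ d\<close> by (rule mult_right_mono) simp
      finally have "i * 2 ^ l + q < 2 ^ d * 2 ^ l" by (simp only: Suc_eq_plus1[symmetric] Suc_le_eq)
      then have "2 * (i * 2 ^ l + q) + 1 < 2 * (2 ^ d * 2 ^ l)" by (rule double_less)
      then have "w < 2 ^ l * (2 * (2 ^ d * 2 ^ l))"
        unfolding w_def by (intro mult_strict_left_mono) auto
      also have "\<dots> = 2 ^ (l + (1 + (d + l)))" by (simp only: power_add power_one_right)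
      also have "l + (1 + (d + l)) = 2 * l + d + 1" by simp
      finally have "Suc w \<le> 2 ^ (2 * l + d + 1)" by (rule Suc_leI)
      then have "(2::nat) ^ length (inv string_code w) \<le> 2 ^ (2 * l + d + 1)"
        using string_code_bounds(1)[of "inv string_code w"] by simp
      then show ?thesis by (simp only: power_increasing_iff)
    qed
    ultimately have "complexity V x + enat c \<le> enat (2 * l + d + 1) + enat c"
      by (meson add_right_mono enat_ord_simps(1) order_trans)
    also have "\<dots> = enat (2 * l + d + (c + 1))" by simp
    finally show ?thesis using c order_trans by blast
  qed
  then show ?thesis by blast
qed

section \<open>Hypercontractivity of the noise\<close>

text \<open>Both sides agree at 0 to first order, so it suffices to compare second derivatives.
  There AM-GM and \<open>(1 + t) * (1 - t) \<le> 1\<close> give the bound 2, as the exponent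
  \<open>p - 2\<close> is not positive.\<close>

lemma powr_mean_ge_quadratic:
  fixes p x :: real
  assumes p: "1 \<le> p" "p \<le> 2" and x: "0 \<le> x" "x \<le> 1"
  shows "2 + p * (p - 1) * x\<^sup>2 \<le> (1 + x) powr p + (1 - x) powr p"
proof -
  have second: "2 \<le> (1 + t) powr (p - 2) + (1 - t) powr (p - 2)" if t: "0 \<le> t" "t < 1" for t :: real
  proof -
    let ?a = "(1 + t) powr ((p - 2) / 2)" and ?b = "(1 - t) powr ((p - 2) / 2)"
    have "?a * ?b = ((1 + t) * (1 - t)) powr ((p - 2) / 2)"
      using t by (simp add: powr_mult)
    also have "\<dots> \<ge> 1"
    proof -
      have "(1 + t) * (1 - t) \<le> 1" "0 < (1 + t) * (1 - t)" using t by (simp add: algebra_simps, simp)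
      then have "1 powr ((p - 2) / 2) \<le> ((1 + t) * (1 - t)) powr ((p - 2) / 2)"
        using p by (intro powr_mono2') auto
      then show ?thesis by simp
    qed
    finally have "2 \<le> 2 * (?a * ?b)" by simp
    also have "\<dots> \<le> ?a\<^sup>2 + ?b\<^sup>2" using sum_squares_bound[of ?a ?b] by (simp add: mult.assoc)
    also have "\<dots> = (1 + t) powr (p - 2) + (1 - t) powr (p - 2)"
      by (simp add: power2_eq_square flip: powr_add)
    finally show ?thesis .
  qed
  have first: "0 \<le> p * (1 + t) powr (p - 1) - p * (1 - t) powr (p - 1) - 2 * p * (p - 1) * t"
    if t: "0 \<le> t" "t < 1" for t :: real
  proof -
    let ?f = "\<lambda>t. p * (1 + t) powr (p - 1) - p * (1 - t) powr (p - 1) - 2 * p * (p - 1) * t"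
    have "?f 0 \<le> ?f t"
    proof (rule DERIV_nonneg_imp_nondecreasing[OF t(1)])
      fix u :: real
      assume u: "0 \<le> u" "u \<le> t"
      have "(?f has_real_derivative p * (p - 1) * ((1 + u) powr (p - 2) + (1 - u) powr (p - 2) - 2)) (at u)"
        using u t by (auto intro!: derivative_eq_intros simp: algebra_simps)
      moreover have "0 \<le> p * (p - 1) * ((1 + u) powr (p - 2) + (1 - u) powr (p - 2) - 2)"
        using p second[of u] u t by (intro mult_nonneg_nonneg) auto
      ultimately show "\<exists>y. (?f has_real_derivative y) (at u) \<and> 0 \<le> y" by blast
    qed
    then show ?thesis by simp
  qed
  let ?g = "\<lambda>x. (1 + x) powr p + (1 - x) powr p - p * (p - 1) * x\<^sup>2"
  have "?g 0 \<le> ?g x"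
  \<comment> \<open>At 1 the base \<open>1 - x\<close> vanishes; derivatives on the open interval
    and continuity up to its ends suffice.\<close>
  proof (rule DERIV_nonneg_imp_increasing_open[OF x(1)])
    fix u :: real
    assume u: "0 < u" "u < x"
    have "(?g has_real_derivative
        p * (1 + u) powr (p - 1) - p * (1 - u) powr (p - 1) - 2 * p * (p - 1) * u) (at u)"
      using u x by (auto intro!: derivative_eq_intros)
    then show "\<exists>y. (?g has_real_derivative y) (at u) \<and> 0 \<le> y"
      using first[of u] u x by force
  next
    show "continuous_on {0..x} ?g"
      using p x by (intro continuous_on_powr' continuous_intros) auto
  qed
  then show ?thesis by simp
qed

text \<open>Weighted AM-GM for \<open>1 + y\<close> and 1 with weights \<open>s\<close> and
  \<open>1 - s\<close>.\<close>

lemma powr_le_Bernoulli: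
  fixes s y :: real
  assumes "0 \<le> y" "0 \<le> s" "s \<le> 1"
  shows "(1 + y) powr s \<le> 1 + s * y"
  using Youngs_inequality_0[of s "1 - s" "1 + y" 1] assms by (simp add: algebra_simps)

text \<open>Bonami's two-point inequality: noise of correlation \<open>\<rho>\<close> contracts from
  L_p to L_2 on a uniform bit. Sums replace means here, hence the power of 2.\<close>

lemma two_point_norm:
  fixes \<rho> a b :: real
  assumes \<rho>: "\<bar>\<rho>\<bar> \<le> 1" and ab: "0 \<le> a" "0 \<le> b"
  defines "p \<equiv> 1 + \<rho>\<^sup>2"
  shows "sqrt ((((1 + \<rho>) * a + (1 - \<rho>) * b) / 2)\<^sup>2 + (((1 - \<rho>) * a + (1 + \<rho>) * b) / 2)\<^sup>2)
    \<le> 2 powr (1 / 2 - 1 / p) * (a powr p + b powr p) powr (1 / p)"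
proof -
  have p: "1 \<le> p" "p \<le> 2" using \<rho> by (auto simp: p_def abs_square_le_1)
  \<comment> \<open>Up to order, the two numbers are \<open>m * (1 + x)\<close> and
    \<open>m * (1 - x)\<close>; the noise keeps their mean \<open>m\<close> and scales the deviation
    from it by \<open>\<rho>\<close>.\<close>
  have symmetric_case: "sqrt (2 * m\<^sup>2 * (1 + \<rho>\<^sup>2 * x\<^sup>2))
      \<le> 2 powr (1 / 2 - 1 / p) * ((m * (1 + x)) powr p + (m * (1 - x)) powr p) powr (1 / p)"
    if "0 \<le> m" "0 \<le> x" "x \<le> 1" for m x :: real
  proof -
    have "(1 + \<rho>\<^sup>2 * x\<^sup>2) powr (p / 2) \<le> 1 + p / 2 * (\<rho>\<^sup>2 * x\<^sup>2)"
      using p by (intro powr_le_Bernoulli) auto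
    then have "2 * (1 + \<rho>\<^sup>2 * x\<^sup>2) powr (p / 2) \<le> 2 * (1 + p / 2 * (\<rho>\<^sup>2 * x\<^sup>2))"
      by simp
    \<comment> \<open>The choice of \<open>p\<close> makes the quadratic terms match:
      \<open>p - 1\<close> is \<open>\<rho>\<^sup>2\<close>.\<close>
    also have "\<dots> = 2 + p * (p - 1) * x\<^sup>2"
      by (simp add: p_def algebra_simps)
    also have "\<dots> \<le> (1 + x) powr p + (1 - x) powr p"
      by (rule powr_mean_ge_quadratic) (use p that in auto)
    finally have "(2 * (1 + \<rho>\<^sup>2 * x\<^sup>2) powr (p / 2)) powr (1 / p)
        \<le> ((1 + x) powr p + (1 - x) powr p) powr (1 / p)"
      using p by (intro powr_mono2) auto
    also have "(2 * (1 + \<rho>\<^sup>2 * x\<^sup>2) powr (p / 2)) powr (1 / p) = 2 powr (1 / p) * sqrt (1 + \<rho>\<^sup>2 * x\<^sup>2)"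
      using p by (simp add: powr_mult powr_powr powr_half_sqrt)
    finally have *: "2 powr (1 / p) * sqrt (1 + \<rho>\<^sup>2 * x\<^sup>2)
        \<le> ((1 + x) powr p + (1 - x) powr p) powr (1 / p)" .
    have "sqrt (2 * m\<^sup>2 * (1 + \<rho>\<^sup>2 * x\<^sup>2)) = 2 powr (1 / 2 - 1 / p) * m * (2 powr (1 / p) * sqrt (1 + \<rho>\<^sup>2 * x\<^sup>2))"
      using that by (simp add: real_sqrt_mult powr_diff powr_half_sqrt)
    also have "\<dots> \<le> 2 powr (1 / 2 - 1 / p) * m * ((1 + x) powr p + (1 - x) powr p) powr (1 / p)"
      using that by (intro mult_left_mono *) auto
    also have "\<dots> = 2 powr (1 / 2 - 1 / p) * (m powr p * ((1 + x) powr p + (1 - x) powr p)) powr (1 / p)"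
      using p that by (simp add: powr_mult powr_powr)
    also have "m powr p * ((1 + x) powr p + (1 - x) powr p) = (m * (1 + x)) powr p + (m * (1 - x)) powr p"
      using that by (simp add: powr_mult distrib_left[of "m powr p"])
    finally show ?thesis .
  qed
  define m where "m = (a + b) / 2"
  \<comment> \<open>If the mean is 0, both numbers are 0, and the relative deviation can be set to
    0.\<close>
  define x where "x = (if m = 0 then 0 else \<bar>a - b\<bar> / (2 * m))"
  have "0 \<le> m" "0 \<le> x" using ab by (auto simp: m_def x_def)
  have "a = b" if "m = 0" using that ab by (simp add: m_def)
  then have mx: "m * x = \<bar>a - b\<bar> / 2" by (cases "m = 0") (auto simp: x_def)
  have "\<bar>a - b\<bar> \<le> 2 * m" using ab by (auto simp: m_def abs_if)
  then have "x \<le> 1" using \<open>0 \<le> m\<close> by (auto simp: x_def divide_le_eq_1)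
  have "2 * m\<^sup>2 * (1 + \<rho>\<^sup>2 * x\<^sup>2) = 2 * m\<^sup>2 + 2 * \<rho>\<^sup>2 * (m * x)\<^sup>2"
    by (simp add: algebra_simps power2_eq_square)
  also have "\<dots> = (((1 + \<rho>) * a + (1 - \<rho>) * b) / 2)\<^sup>2 + (((1 - \<rho>) * a + (1 + \<rho>) * b) / 2)\<^sup>2"
    unfolding mx by (simp add: m_def power_divide field_simps power2_eq_square)
  finally have lhs: "2 * m\<^sup>2 * (1 + \<rho>\<^sup>2 * x\<^sup>2) = \<dots>" .
  have "(m * (1 + x)) powr p + (m * (1 - x)) powr p = a powr p + b powr p"
    unfolding distrib_left right_diff_distrib mx by (cases "a \<le> b") (auto simp: m_def field_simps)
  then show ?thesis
    using symmetric_case[OF \<open>0 \<le> m\<close> \<open>0 \<le> x\<close> \<open>x \<le> 1\<close>] unfolding lhs by simp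
qed

section \<open>Noise on strings: from one bit to n bits\<close>

lemma sum_lists_Suc:
  "(\<Sum>x | length x = Suc n. f x) = (\<Sum>b\<in>UNIV. \<Sum>x | length x = n. f (b # x))"
  for f :: "bool list \<Rightarrow> real"
proof -
  have "{x :: bool list. length x = Suc n} = (\<lambda>(b, x). b # x) ` (UNIV \<times> {x. length x = n})"
    by (auto simp: length_Suc_conv)
  then have "(\<Sum>x | length x = Suc n. f x) = (\<Sum>(b, x)\<in>UNIV \<times> {x. length x = n}. f (b # x))"
    by (simp add: sum.reindex inj_on_def case_prod_unfold)
  then show ?thesis by (simp add: sum.cartesian_product)
qed

lemma finite_lists_length: "finite {x :: bool list. length x = n}"
  using finite_lists_length_eq[of "UNIV :: bool set"] by simp

definition hamming :: "bool list \<Rightarrow> bool list \<Rightarrow> nat" where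
  "hamming x y = (\<Sum>i<length x. of_bool (x ! i \<noteq> y ! i))"

lemma hamming_Cons: "hamming (a # x) (b # y) = of_bool (a \<noteq> b) + hamming x y"
  by (simp add: hamming_def sum.lessThan_Suc_shift del: sum.lessThan_Suc)

lemma hamming_le: "hamming x y \<le> length x"
  unfolding hamming_def by (rule order_trans[OF sum_bounded_above[of _ _ 1]]) auto

context
  fixes \<tau> :: real
  assumes \<tau>: "0 < \<tau>" "\<tau> < 1"
begin

lemma pmf_noise_Cons: "pmf (noise \<tau> (a # x)) (b # y) = (if a = b then 1 - \<tau> else \<tau>) * pmf (noise \<tau> x) y"
proof -
  have "noise \<tau> (a # x) = bernoulli_pmf \<tau> \<bind> (\<lambda>flip. map_pmf ((#) (if flip then \<not> a else a)) (noise \<tau> x))"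
    by (simp add: map_pmf_def)
  moreover have "pmf (map_pmf ((#) c) (noise \<tau> x)) (b # y) = (if c = b then pmf (noise \<tau> x) y else 0)" for c
  proof (cases "c = b")
    case True
    then show ?thesis by (simp add: pmf_map_inj')
  next
    case False
    then show ?thesis by (auto simp: pmf_eq_0_set_pmf)
  qed
  ultimately show ?thesis
    using \<tau> by (auto simp: pmf_bind)
qed

lemma pmf_noise:
  "length x = length y \<Longrightarrow> pmf (noise \<tau> x) y = \<tau> ^ hamming x y * (1 - \<tau>) ^ (length x - hamming x y)"
proof (induction x y rule: list_induct2)
  case (Cons a x b y)
  then show ?case
    using hamming_le[of x y]
    by (auto simp: pmf_noise_Cons hamming_Cons Suc_diff_le simp del: noise.simps)
qed (simp add: hamming_def)

lemma set_pmf_noise: "y \<in> set_pmf (noise \<tau> x) \<Longrightarrow> length y = length x"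
  by (induction x arbitrary: y) auto

text \<open>Bilinear form of the contraction from L_p to L_2, again with sums for means. Splitting
  off the first bit gives four blocks, each bounded by induction; Cauchy-Schwarz and the two-point
  inequality for \<open>G True\<close> and \<open>G False\<close> recombine them.\<close>

lemma noise_hypercontractive:
  fixes f g :: "bool list \<Rightarrow> real"
  assumes "\<And>x. 0 \<le> f x" "\<And>x. 0 \<le> g x"
  defines "p \<equiv> 1 + (1 - 2 * \<tau>)\<^sup>2"
  shows "(\<Sum>x | length x = n. \<Sum>y | length y = n. f x * pmf (noise \<tau> x) y * g y)
    \<le> (2 powr (1 / 2 - 1 / p)) ^ n * sqrt (\<Sum>x | length x = n. (f x)\<^sup>2)
      * (\<Sum>y | length y = n. g y powr p) powr (1 / p)"
  using assms(1,2)
proof (induction n arbitrary: f g)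
  case 0
  have "0 < p" by (simp add: p_def add_pos_nonneg)
  then show ?case using 0 by (simp add: powr_powr)
next
  case (Suc n)
  have "0 < p" by (simp add: p_def add_pos_nonneg)
  let ?c = "2 powr (1 / 2 - 1 / p)"
  define F where "F a = sqrt (\<Sum>x | length x = n. (f (a # x))\<^sup>2)" for a
  define G where "G b = (\<Sum>y | length y = n. g (b # y) powr p) powr (1 / p)" for b
  define K where "K a b = (if a = b then 1 - \<tau> else \<tau>)" for a b :: bool
  have nonneg: "0 \<le> F a" "0 \<le> G a" "0 \<le> K a b" for a b
    using \<tau> by (auto simp: F_def G_def K_def sum_nonneg)
  have "(\<Sum>x | length x = Suc n. \<Sum>y | length y = Suc n. f x * pmf (noise \<tau> x) y * g y)
      = (\<Sum>a\<in>UNIV. \<Sum>b\<in>UNIV. K a b * (\<Sum>x | length x = n. \<Sum>y | length y = n.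
          f (a # x) * pmf (noise \<tau> x) y * g (b # y)))"
    unfolding sum_lists_Suc pmf_noise_Cons K_def[symmetric] sum_distrib_left
    by (intro sum.cong refl, subst sum.swap, intro sum.cong refl) (simp add: mult_ac)
  also have "\<dots> \<le> (\<Sum>a\<in>UNIV. \<Sum>b\<in>UNIV. K a b * (?c ^ n * F a * G b))"
    unfolding F_def G_def using nonneg Suc.prems
    by (intro sum_mono mult_left_mono Suc.IH) auto
  also have "\<dots> = ?c ^ n * (F True * (\<Sum>b\<in>UNIV. K True b * G b) + F False * (\<Sum>b\<in>UNIV. K False b * G b))"
    by (simp add: UNIV_bool algebra_simps)
  also have "\<dots> \<le> ?c ^ n * (sqrt ((F True)\<^sup>2 + (F False)\<^sup>2) *
      sqrt ((\<Sum>b\<in>UNIV. K True b * G b)\<^sup>2 + (\<Sum>b\<in>UNIV. K False b * G b)\<^sup>2))"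
  proof (intro mult_left_mono)
    \<comment> \<open>Cauchy-Schwarz for two terms, from Lagrange's identity.\<close>
    have "(u * v + u' * v')\<^sup>2 \<le> (u\<^sup>2 + u'\<^sup>2) * (v\<^sup>2 + v'\<^sup>2)" for u v u' v' :: real
      using zero_le_power2[of "u * v' - u' * v"] by (simp add: power2_eq_square algebra_simps)
    then show "F True * (\<Sum>b\<in>UNIV. K True b * G b) + F False * (\<Sum>b\<in>UNIV. K False b * G b)
        \<le> sqrt ((F True)\<^sup>2 + (F False)\<^sup>2) * sqrt ((\<Sum>b\<in>UNIV. K True b * G b)\<^sup>2 + (\<Sum>b\<in>UNIV. K False b * G b)\<^sup>2)"
      unfolding real_sqrt_mult[symmetric] by (intro real_le_rsqrt)
  qed simp
  also have "\<dots> \<le> ?c ^ n * (sqrt ((F True)\<^sup>2 + (F False)\<^sup>2) *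
      (?c * (G True powr p + G False powr p) powr (1 / p)))"
  proof (intro mult_left_mono)
    \<comment> \<open>Flipping one bit with probability \<open>\<tau>\<close> is noise of
      correlation \<open>1 - 2 * \<tau>\<close>.\<close>
    have kernel: "(\<Sum>b\<in>UNIV. K True b * G b) = ((1 + (1 - 2 * \<tau>)) * G True + (1 - (1 - 2 * \<tau>)) * G False) / 2"
      "(\<Sum>b\<in>UNIV. K False b * G b) = ((1 - (1 - 2 * \<tau>)) * G True + (1 + (1 - 2 * \<tau>)) * G False) / 2"
      by (simp_all add: UNIV_bool K_def field_simps)
    show "sqrt ((\<Sum>b\<in>UNIV. K True b * G b)\<^sup>2 + (\<Sum>b\<in>UNIV. K False b * G b)\<^sup>2)
        \<le> ?c * (G True powr p + G False powr p) powr (1 / p)"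
      unfolding kernel p_def using \<tau> nonneg by (intro two_point_norm) auto
  qed auto
  also have "\<dots> = ?c ^ Suc n * sqrt (\<Sum>x | length x = Suc n. (f x)\<^sup>2)
      * (\<Sum>y | length y = Suc n. g y powr p) powr (1 / p)"
  proof -
    have "G b powr p = (\<Sum>y | length y = n. g (b # y) powr p)" for b
      using \<open>0 < p\<close> by (simp add: G_def powr_powr sum_nonneg)
    moreover have "(F a)\<^sup>2 = (\<Sum>x | length x = n. (f (a # x))\<^sup>2)" for a
      by (simp add: F_def sum_nonneg)
    ultimately show ?thesis
      unfolding sum_lists_Suc by (simp add: UNIV_bool add.commute)
  qed
  finally show ?case .
qed

text \<open>Hypercontractivity is applied to the indicators of \<open>A\<close> and
  \<open>B\<close>, where its left side is at least \<open>\<epsilon> * card A\<close>. Cancelling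
  \<open>sqrt (card A)\<close> and squaring bounds \<open>card A\<close>.\<close>

lemma card_noise_likely:
  assumes A: "\<And>x. x \<in> A \<Longrightarrow> length x = n \<and> \<epsilon> \<le> measure_pmf.prob (noise \<tau> x) B" and \<epsilon>: "0 < \<epsilon>"
    and B: "\<And>y. y \<in> B \<Longrightarrow> length y = n"
  defines "p \<equiv> 1 + (1 - 2 * \<tau>)\<^sup>2"
  shows "real (card A) \<le> 2 powr (real n * (1 - 2 / p)) * real (card B) powr (2 / p) / \<epsilon>\<^sup>2"
proof -
  have fin: "finite A" "finite B"
    by (rule finite_subset[OF _ finite_lists_length[of n]]; use A B in blast)+
  have "0 < p" by (simp add: p_def add_pos_nonneg)
  let ?c = "2 powr (1 / 2 - 1 / p)"
  have "\<epsilon> * card A = (\<Sum>x\<in>A. \<epsilon>)" by simp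
  also have "\<dots> \<le> (\<Sum>x\<in>A. \<Sum>y\<in>B. pmf (noise \<tau> x) y)"
    using A fin by (intro sum_mono) (simp add: measure_measure_pmf_finite)
  also have "\<dots> = (\<Sum>x | length x = n. \<Sum>y | length y = n. indicator A x * pmf (noise \<tau> x) y * indicator B y)"
  proof -
    have "(\<Sum>y\<in>B. pmf (noise \<tau> x) y) = (\<Sum>y | length y = n. pmf (noise \<tau> x) y * indicator B y)" for x
      using B by (intro sum.mono_neutral_cong_left finite_lists_length) auto
    moreover have "(\<Sum>x\<in>A. h x) = (\<Sum>x | length x = n. indicator A x * h x)" for h :: "bool list \<Rightarrow> real"
      using A by (intro sum.mono_neutral_cong_left finite_lists_length) auto
    ultimately show ?thesis by (simp add: sum_distrib_left mult.assoc)
  qed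
  also have "\<dots> \<le> ?c ^ n * sqrt (\<Sum>x | length x = n. (indicator A x)\<^sup>2)
      * (\<Sum>y | length y = n. indicator B y powr p) powr (1 / p)"
    unfolding p_def by (rule noise_hypercontractive) auto
  also have "(\<Sum>x | length x = n. (indicator A x)\<^sup>2) = (\<Sum>x\<in>A. 1 :: real)"
    using A by (intro sum.mono_neutral_cong_right finite_lists_length) auto
  also have "(\<Sum>y | length y = n. indicator B y powr p) = (\<Sum>y\<in>B. 1 :: real)"
    using B by (intro sum.mono_neutral_cong_right finite_lists_length) auto
  finally have *: "\<epsilon> * card A \<le> ?c ^ n * sqrt (card A) * card B powr (1 / p)" by simp
  have "\<epsilon> * sqrt (card A) \<le> ?c ^ n * card B powr (1 / p)"
  proof (cases "card A = 0")
    case False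
    then have "0 < sqrt (card A)" by simp
    moreover have "sqrt (card A) * (\<epsilon> * sqrt (card A)) \<le> sqrt (card A) * (?c ^ n * card B powr (1 / p))"
      using * by (simp add: mult_ac)
    ultimately show ?thesis by (simp only: mult_le_cancel_left_pos)
  qed simp
  then have "(\<epsilon> * sqrt (card A))\<^sup>2 \<le> (?c ^ n * card B powr (1 / p))\<^sup>2"
    using \<epsilon> by (intro power_mono) auto
  then have "\<epsilon>\<^sup>2 * card A \<le> (?c ^ n)\<^sup>2 * (card B powr (1 / p))\<^sup>2"
    by (simp add: power_mult_distrib)
  also have "(?c ^ n)\<^sup>2 = 2 powr (real n * (1 - 2 / p))"
    by (simp add: powr_realpow[symmetric] powr_powr power2_eq_square powr_add[symmetric] algebra_simps)
  also have "(card B powr (1 / p))\<^sup>2 = card B powr (2 / p)"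
    by (simp add: power2_eq_square powr_add[symmetric])
  finally show ?thesis using \<epsilon> by (simp add: field_simps)
qed

end

section \<open>Strings with many simple neighbours on a Hamming sphere\<close>

text \<open>Reading the bits off the shifted code makes the Hamming distance an arithmetic function
  of codes.\<close>

lemma nth_string_code: "i < length x \<Longrightarrow> x ! i \<longleftrightarrow> Suc (string_code x) div 2 ^ i mod 2 = 1"
proof (induction x arbitrary: i)
  case (Cons b x)
  have *: "Suc (string_code (b # x)) = of_bool b + 2 * Suc (string_code x)" by simp
  show ?case
  proof (cases i)
    case 0
    then show ?thesis unfolding * by simp
  next
    case (Suc j)
    then show ?thesis
      using Cons unfolding * Suc power_Suc div_mult2_eq by simp
  qed
qed simp

lemma hamming_string_code:
  assumes "length x = n" "length y = n"
  shows "hamming x y = (\<Sum>i<n. of_bool (Suc (string_code x) div 2 ^ i mod 2 \<noteq> Suc (string_code y) div 2 ^ i mod 2))"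
  unfolding hamming_def assms(1)
  by (intro sum.cong refl) (auto simp: nth_string_code assms)

text \<open>The Cantor pairing is quadratic, so packing two numbers of \<open>l\<close> bits costs
  one bit beyond \<open>2 * l\<close>.\<close>

lemma prod_encode_less:
  assumes "a < 2 ^ l" "b < 2 ^ l"
  shows "prod_encode (a, b) < 2 ^ (2 * l + 1)"
proof -
  obtain M :: nat where M: "2 ^ l = Suc M" by (metis not0_implies_Suc power_not_zero zero_neq_numeral)
  have ab: "a \<le> M" "b \<le> M" using assms M by auto
  have "2 * prod_encode (a, b) = (a + b) * Suc (a + b) + 2 * a"
    by (simp add: prod_encode_def triangle_def)
  also have "\<dots> \<le> (2 * M) * Suc (2 * M) + 2 * M"
    using ab by (intro add_mono mult_mono) auto
  also have "\<dots> < 4 * (Suc M * Suc M)" by simp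
  also have "\<dots> = 2 * 2 ^ (2 * l + 1)"
    unfolding M[symmetric] by (simp add: mult_2 power_add)
  finally show ?thesis by simp
qed

text \<open>Membership is a lower bound on a count of simple neighbours, so it is confirmed once
  programs for enough of them have halted.\<close>

definition rich_strings :: "(bool list \<rightharpoonup> bool list) \<Rightarrow> nat \<Rightarrow> nat \<Rightarrow> nat \<Rightarrow> nat \<Rightarrow> bool list set" where
  "rich_strings U n k t m = {x. length x = n \<and>
     2 ^ t \<le> card {y. length y = n \<and> hamming x y = k \<and> complexity U y \<le> enat m}}"

text \<open>The set is enumerable uniformly in its four parameters. Packed into one number they take
  \<open>4 * l + 3\<close> bits, which \<open>complexity_enumerable\<close> doubles; this gives
  \<open>8 * l\<close> and a constant 6.\<close>

lemma complexity_rich_strings: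
  assumes U: "optimal U"
  shows "\<exists>c. \<forall>n k t m l d x. n < 2 ^ l \<longrightarrow> k < 2 ^ l \<longrightarrow> t < 2 ^ l \<longrightarrow> m < 2 ^ l \<longrightarrow>
    x \<in> rich_strings U n k t m \<longrightarrow> card (rich_strings U n k t m) \<le> 2 ^ d \<longrightarrow>
    complexity U x \<le> enat (8 * l + d + c)"
proof -
  obtain g where g: "partial_recursive g" "\<And>p. g (string_code p) = map_option string_code (U p)"
    using U unfolding optimal_def computable_def by blast
  then obtain G where G: "approximates G g"
    using partial_recursive_approximation by blast
  \<comment> \<open>The simple neighbours on the sphere that are found within \<open>s\<close>
    steps.\<close>
  define Y where "Y n k m x s = {y. length y = n \<and> hamming x y = k \<and>
    (\<exists>p. length p \<le> m \<and> G (string_code p) s = Some (string_code y))}" for n k m x s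
  \<comment> \<open>The condition \<open>2 ^ t \<le> card (Y n k m x s)\<close> together with the
    length, restated on codes with bounded sums and quantifiers only.\<close>
  define R where "R q a s \<longleftrightarrow> (let n = pfst (pfst q); k = psnd (pfst q); t = pfst (psnd q); m = psnd (psnd q) in
    2 ^ n \<le> Suc a \<and> Suc a < 2 ^ Suc n \<and>
    2 ^ t \<le> (\<Sum>b<2 ^ Suc n - 1. of_bool (2 ^ n \<le> Suc b \<and>
      (\<Sum>i<n. of_bool (Suc a div 2 ^ i mod 2 \<noteq> Suc b div 2 ^ i mod 2)) = k \<and>
      (\<exists>p<2 ^ Suc m - 1. opt_code (G p s) = Suc b)) :: nat))" for q a s
  have "decidable (\<lambda>w. R (pfst w) (pfst (psnd w)) (psnd (psnd w)))"
    unfolding R_def Let_def by (intro recursive_intros G[THEN approximates_total_recursive])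
  then obtain c where c: "\<And>q l d x. q < 2 ^ l \<Longrightarrow> finite {a. \<exists>s. R q a s} \<Longrightarrow>
      card {a. \<exists>s. R q a s} \<le> 2 ^ d \<Longrightarrow> \<exists>s. R q (string_code x) s \<Longrightarrow>
      complexity U x \<le> enat (2 * l + d + c)"
    using complexity_enumerable[OF U, of R] by blast
  have "complexity U x \<le> enat (8 * l + d + (c + 6))"
    if less: "n < 2 ^ l" "k < 2 ^ l" "t < 2 ^ l" "m < 2 ^ l" and x: "x \<in> rich_strings U n k t m"
      and card: "card (rich_strings U n k t m) \<le> 2 ^ d" for n k t m l d x
  proof -
    let ?q = "prod_encode (prod_encode (n, k), prod_encode (t, m))"
    have "?q < 2 ^ (2 * (2 * l + 1) + 1)"
      by (intro prod_encode_less less)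
    also have "2 * (2 * l + 1) + 1 = 4 * l + 3" by simp
    finally have q: "?q < 2 ^ (4 * l + 3)" .
    have finite_Y: "finite (Y n k m z s)" for z s
      by (rule finite_subset[OF _ finite_lists_length[of n]]) (auto simp: Y_def)
    have R_iff: "R ?q (string_code z) s \<longleftrightarrow> length z = n \<and> 2 ^ t \<le> card (Y n k m z s)" for z s
    proof (cases "length z = n")
      case True
      have "{b. b < 2 ^ Suc n - 1 \<and> 2 ^ n \<le> Suc b \<and>
          (\<Sum>i<n. of_bool (Suc (string_code z) div 2 ^ i mod 2 \<noteq> Suc b div 2 ^ i mod 2)) = k \<and>
          (\<exists>p<2 ^ Suc m - 1. opt_code (G p s) = Suc b)} = string_code ` Y n k m z s" (is "?L = ?R")
      proof (intro set_eqI)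
        fix b
        obtain y where b: "b = string_code y" using surj_string_code by (metis surjD)
        have p: "(\<exists>p<2 ^ Suc m - 1. opt_code (G p s) = Suc b) \<longleftrightarrow>
            (\<exists>p. length p \<le> m \<and> G (string_code p) s = Some (string_code y))"
          unfolding opt_code_eq_Suc b length_le_iff_string_code by (metis string_code_inv)
        have "b < 2 ^ Suc n - 1 \<and> 2 ^ n \<le> Suc b \<longleftrightarrow> length y = n"
          unfolding b length_eq_iff_string_code by linarith
        then have "b \<in> ?L \<longleftrightarrow> y \<in> Y n k m z s"
          unfolding Y_def mem_Collect_eq p using hamming_string_code[OF True, of y] b by auto
        also have "\<dots> \<longleftrightarrow> b \<in> ?R"
          unfolding b by (simp add: inj_image_mem_iff[OF inj_string_code])
        finally show "b \<in> ?L \<longleftrightarrow> b \<in> ?R" .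
      qed
      then show ?thesis
        using True string_code_bounds[of z] unfolding R_def Let_def sum_of_bool_eq_card
        by (simp add: card_image[OF inj_on_subset[OF inj_string_code subset_UNIV]])
    next
      case False
      then show ?thesis
        unfolding R_def Let_def prod_encode_inverse fst_conv snd_conv length_eq_iff_string_code[of z]
        by blast
    qed
    have R_rich: "(\<exists>s. R ?q (string_code z) s) \<longleftrightarrow> z \<in> rich_strings U n k t m" for z
    proof -
      let ?Z = "{y. length y = n \<and> hamming z y = k \<and> complexity U y \<le> enat m}"
      have "finite ?Z"
        by (rule finite_subset[OF _ finite_lists_length[of n]]) auto
      have U_iff: "U p = Some y \<longleftrightarrow> (\<exists>s. G (string_code p) s = Some (string_code y))" for p y
        using g(2)[of p] approximates_iff[OF G] inj_string_code
        by (metis (no_types, lifting) injD map_option_eq_Some option.simps(9))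
      have "Y n k m z s \<subseteq> ?Z" for s
        unfolding Y_def complexity_le_iff U_iff by blast
      then have "card (Y n k m z s) \<le> card ?Z" for s
        by (intro card_mono \<open>finite ?Z\<close>)
      moreover have "\<exists>s. ?Z \<subseteq> Y n k m z s"
      proof -
        have "\<forall>y\<in>?Z. \<exists>s. \<exists>p. length p \<le> m \<and> G (string_code p) s = Some (string_code y)"
          unfolding complexity_le_iff U_iff by blast
        then obtain \<sigma> where \<sigma>: "\<forall>y\<in>?Z. \<exists>p. length p \<le> m \<and> G (string_code p) (\<sigma> y) = Some (string_code y)"
          by metis
        \<comment> \<open>The neighbours are finitely many, so the sum of their budgets serves all
          of them at once.\<close>
        have "\<sigma> y \<le> (\<Sum>y\<in>?Z. \<sigma> y)" if "y \<in> ?Z" for y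
          by (rule member_le_sum[OF that _ \<open>finite ?Z\<close>]) simp
        then have "?Z \<subseteq> Y n k m z (\<Sum>y\<in>?Z. \<sigma> y)"
          using \<sigma> approximates_mono[OF G] unfolding Y_def by blast
        then show ?thesis by blast
      qed
      then have "\<exists>s. card ?Z \<le> card (Y n k m z s)"
        using finite_Y card_mono by blast
      ultimately show ?thesis
        unfolding R_iff rich_strings_def mem_Collect_eq by (meson order_trans)
    qed
    have "{a. \<exists>s. R ?q a s} = string_code ` rich_strings U n k t m"
    proof (intro set_eqI)
      fix a
      obtain z where "a = string_code z" using surj_string_code by (metis surjD)
      then show "a \<in> {a. \<exists>s. R ?q a s} \<longleftrightarrow> a \<in> string_code ` rich_strings U n k t m"
        using R_rich[of z] by (simp add: inj_image_mem_iff[OF inj_string_code])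
    qed
    moreover have "finite (rich_strings U n k t m)"
      by (rule finite_subset[OF _ finite_lists_length[of n]]) (auto simp: rich_strings_def)
    ultimately have "complexity U x \<le> enat (2 * (4 * l + 3) + d + c)"
      using card x R_rich
      by (intro c[OF q]) (simp_all add: card_image[OF inj_on_subset[OF inj_string_code subset_UNIV]])
    then show ?thesis by (simp add: algebra_simps)
  qed
  then show ?thesis by blast
qed

section \<open>The complexity of a string with noise\<close>

text \<open>Each program generates at most one string, and fewer than \<open>2 ^ Suc m\<close>
  programs have length at most \<open>m\<close>.\<close>

lemma card_complexity_le: "finite {y. complexity U y \<le> enat m} \<and> card {y. complexity U y \<le> enat m} \<le> 2 ^ Suc m"
proof -
  let ?P = "{p :: bool list. length p \<le> m}"
  have image: "string_code ` ?P \<subseteq> {..<2 ^ Suc m - 1}" by (auto simp: length_le_iff_string_code simp del: power_Suc)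
  have "finite ?P"
    using finite_imageD[OF finite_subset[OF image]] inj_on_subset[OF inj_string_code] by blast
  have "card ?P \<le> card {..<2 ^ Suc m - 1 :: nat}"
    by (rule card_inj_on_le[OF inj_on_subset[OF inj_string_code] image]) auto
  moreover have sub: "{y. complexity U y \<le> enat m} \<subseteq> (\<lambda>p. the (U p)) ` ?P"
    unfolding complexity_le_iff by force
  moreover have "card ((\<lambda>p. the (U p)) ` ?P) \<le> card ?P"
    by (rule card_image_le[OF \<open>finite ?P\<close>])
  ultimately show ?thesis
    using finite_subset[OF sub] card_mono[OF _ sub] \<open>finite ?P\<close> by auto
qed

text \<open>Of the logarithmic terms, the first comes from the inverse square of the probability
  \<open>?\<epsilon>\<close> and the second from describing the four parameters.\<close>

lemma complexity_noise:
  assumes U: "optimal U" and \<tau>: "0 < \<tau>" "\<tau> < 1"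
  defines "p \<equiv> 1 + (1 - 2 * \<tau>)\<^sup>2"
  shows "\<exists>c. \<forall>n m x. 0 < n \<longrightarrow> m \<le> n \<longrightarrow> length x = n \<longrightarrow>
    1 / real n < measure_pmf.prob (noise \<tau> x) {y. complexity U y \<le> enat m} \<longrightarrow>
    (\<exists>K. complexity U x \<le> enat K \<and> real K \<le> real n * (1 - 2 / p) + 2 / p * (real m + 1)
      + 2 * log 2 (2 * real n * (real n + 1)) + 8 * log 2 (real n + 1) + c)"
proof -
  obtain c where c: "\<And>n k t m l d x. n < 2 ^ l \<Longrightarrow> k < 2 ^ l \<Longrightarrow> t < 2 ^ l \<Longrightarrow> m < 2 ^ l \<Longrightarrow>
    x \<in> rich_strings U n k t m \<Longrightarrow> card (rich_strings U n k t m) \<le> 2 ^ d \<Longrightarrow>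
    complexity U x \<le> enat (8 * l + d + c)"
    using complexity_rich_strings[OF U] by blast
  have "0 < p" by (simp add: p_def add_pos_nonneg)
  \<comment> \<open>The constant 9 is 8 for using \<open>Suc l\<close> in place of \<open>l\<close>,
    plus 1 for rounding \<open>D\<close> up.\<close>
  have "\<exists>K. complexity U x \<le> enat K \<and> real K \<le> real n * (1 - 2 / p) + 2 / p * (real m + 1)
      + 2 * log 2 (2 * real n * (real n + 1)) + 8 * log 2 (real n + 1) + (real c + 9)"
    if n: "0 < n" and m: "m \<le> n" and x: "length x = n"
      and prob: "1 / real n < measure_pmf.prob (noise \<tau> x) {y. complexity U y \<le> enat m}" for n m x
  proof -
    define B where "B = {y. length y = n \<and> complexity U y \<le> enat m}"
    define S where "S k z = {y \<in> B. hamming z y = k}" for k z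
    define w where "w k = \<tau> ^ k * (1 - \<tau>) ^ (n - k)" for k
    have w: "0 \<le> w k" for k using \<tau> by (simp add: w_def)
    have "B \<subseteq> {y. complexity U y \<le> enat m}" by (auto simp: B_def)
    then have B: "finite B" "card B \<le> 2 ^ Suc m"
      using card_complexity_le[of U m] finite_subset card_mono by (blast, meson order_trans)
    then have finite_S: "finite (S k z)" for k z by (simp add: S_def)
    have prob_B: "measure_pmf.prob (noise \<tau> z) B = (\<Sum>k\<le>n. card (S k z) * w k)" if z: "length z = n" for z
    proof -
      have "measure_pmf.prob (noise \<tau> z) B = (\<Sum>y\<in>B. w (hamming z y))"
        unfolding measure_measure_pmf_finite[OF B(1)] w_def
        using z by (intro sum.cong refl) (simp add: B_def pmf_noise[OF \<tau>])
      also have "\<dots> = (\<Sum>k\<le>n. \<Sum>y\<in>S k z. w (hamming z y))"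
        unfolding S_def using B(1) hamming_le[of z] z by (intro sum.group[symmetric]) auto
      also have "\<dots> = (\<Sum>k\<le>n. card (S k z) * w k)"
        by (intro sum.cong refl) (simp add: S_def)
      finally show ?thesis .
    qed
    \<comment> \<open>Noise preserves the length, so the restriction to length \<open>n\<close>
      loses no probability.\<close>
    have "measure_pmf.prob (noise \<tau> x) {y. complexity U y \<le> enat m} = measure_pmf.prob (noise \<tau> x) B"
      using set_pmf_noise[OF \<tau>] x by (intro measure_prob_cong_0) (auto simp: B_def set_pmf_iff)
    then have "1 / real n < (\<Sum>k\<le>n. card (S k x) * w k)"
      using prob prob_B[OF x] by simp
    moreover have "1 / real n = (\<Sum>k\<le>n. 1 / (real n * (real n + 1)))"
      using n by (simp add: field_simps add_nonneg_eq_0_iff)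
    \<comment> \<open>Otherwise each of the \<open>n + 1\<close> distances would contribute at most
      an equal share of \<open>1 / real n\<close>.\<close>
    ultimately obtain k where k: "k \<le> n" "1 / (real n * (real n + 1)) < card (S k x) * w k"
      by (metis (no_types, lifting) atMost_iff linorder_not_less sum_mono)
    have "0 < card (S k x)"
      using k(2) n by (intro Nat.gr0I) (auto simp: divide_less_0_iff mult_less_0_iff)
    \<comment> \<open>Rounding the count down to a power of 2 loses less than a factor 2, which
      accounts for the 2 in \<open>?\<epsilon>\<close>.\<close>
    then obtain t where t: "2 ^ t \<le> card (S k x)" "card (S k x) < 2 ^ Suc t"
      using ex_power_ivl1[of 2 "card (S k x)"] by auto
    have "t \<le> Suc m"
    proof -
      have "card (S k x) \<le> card B" using B(1) by (intro card_mono) (auto simp: S_def)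
      then have "(2::nat) ^ t \<le> 2 ^ Suc m" using t(1) B(2) by linarith
      then show ?thesis by (simp only: power_increasing_iff)
    qed
    let ?A = "rich_strings U n k t m"
    let ?\<epsilon> = "1 / (2 * real n * (real n + 1))"
    have rich_iff: "z \<in> ?A \<longleftrightarrow> length z = n \<and> 2 ^ t \<le> card (S k z)" for z
      unfolding rich_strings_def S_def B_def by (simp add: conj_ac)
    have likely: "?\<epsilon> \<le> measure_pmf.prob (noise \<tau> z) B" if "z \<in> ?A" for z
    proof -
      have "real (card (S k x)) \<le> 2 * 2 ^ t"
        using t(2) by (metis less_imp_le of_nat_le_iff of_nat_numeral of_nat_power power_Suc)
      then have "card (S k x) * w k \<le> 2 * 2 ^ t * w k" by (rule mult_right_mono) (rule w)
      then have "1 / (real n * (real n + 1)) \<le> 2 * (2 ^ t * w k)"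
        using k(2) by (simp only: mult.assoc)
      then have "?\<epsilon> \<le> 2 ^ t * w k" by (simp only: mult.assoc divide_divide_eq_left[symmetric])
      also have "\<dots> \<le> card (S k z) * w k"
        using that w by (intro mult_right_mono) (auto simp: rich_iff simp flip: of_nat_le_iff)
      also have "\<dots> \<le> (\<Sum>k\<le>n. card (S k z) * w k)"
        using k(1) w by (intro member_le_sum) auto
      finally show ?thesis using that prob_B rich_iff by simp
    qed
    define D where "D = real n * (1 - 2 / p) + 2 / p * (real m + 1) + 2 * log 2 (2 * real n * (real n + 1))"
    have "real (card ?A) \<le> 2 powr (real n * (1 - 2 / p)) * real (card B) powr (2 / p) / ?\<epsilon>\<^sup>2"
      unfolding p_def using n likely rich_iff
      by (intro card_noise_likely[OF \<tau>]) (auto simp: B_def)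
    also have "\<dots> \<le> 2 powr (real n * (1 - 2 / p)) * (2 powr (real m + 1)) powr (2 / p) / ?\<epsilon>\<^sup>2"
    proof (intro divide_right_mono mult_left_mono powr_mono2)
      have "real (card B) \<le> 2 ^ Suc m" using B(2) by (metis of_nat_le_iff of_nat_numeral of_nat_power)
      also have "\<dots> = 2 powr (real m + 1)" by (simp add: powr_add powr_realpow)
      finally show "real (card B) \<le> 2 powr (real m + 1)" .
    qed (use \<open>0 < p\<close> in auto)
    also have "\<dots> = 2 powr D"
    proof -
      have "2 powr (a + b + 2 * e) = 2 powr a * 2 powr b * (2 powr e)\<^sup>2" for a b e :: real
        by (simp only: powr_add power2_eq_square mult_2)
      moreover have "(2 powr (real m + 1)) powr (2 / p) = 2 powr (2 / p * (real m + 1))"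
        by (simp only: powr_powr mult.commute)
      moreover have "2 powr log 2 (2 * real n * (real n + 1)) = 2 * real n * (real n + 1)"
        using n by (intro powr_log_cancel) auto
      ultimately show ?thesis unfolding D_def by (simp only: power_one_over divide_divide_eq_right div_by_1)
    qed
    finally have card_A: "real (card ?A) \<le> 2 powr D" .
    have "finite ?A"
      by (rule finite_subset[OF _ finite_lists_length[of n]]) (auto simp: rich_iff)
    moreover have "x \<in> ?A" using x t(1) by (simp add: rich_iff)
    \<comment> \<open>Since \<open>x\<close> itself is rich, \<open>D\<close> is nonnegative, so
      rounding by \<open>nat\<close> keeps \<open>d\<close> below \<open>D + 1\<close>.\<close>
    ultimately have "1 \<le> real (card ?A)"
      by (metis One_nat_def Suc_leI card_gt_0_iff empty_iff of_nat_1 of_nat_le_iff)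
    then have "2 powr 0 \<le> 2 powr D" using card_A by simp
    then have "0 \<le> D" by (simp only: powr_le_cancel_iff)
    define d where "d = nat \<lceil>D\<rceil>"
    have d: "D \<le> real d" "real d \<le> D + 1"
      using \<open>0 \<le> D\<close> by (auto simp: d_def intro: order_less_imp_le)
    have "real (card ?A) \<le> 2 powr real d" using card_A d(1) by (meson order_trans powr_mono one_le_numeral)
    then have card_d: "card ?A \<le> 2 ^ d"
      by (metis of_nat_le_iff of_nat_numeral of_nat_power powr_realpow zero_less_numeral)
    \<comment> \<open>The bit length is taken for \<open>n + 1\<close> because \<open>t\<close> can
      be as large as \<open>m + 1\<close>.\<close>
    obtain l where l: "2 ^ l \<le> n + 1" "n + 1 < 2 ^ Suc l"
      using ex_power_ivl1[of 2 "n + 1"] by auto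
    have "n < 2 ^ Suc l" "k < 2 ^ Suc l" "t < 2 ^ Suc l" "m < 2 ^ Suc l"
      using l(2) k(1) m \<open>t \<le> Suc m\<close> by linarith+
    then have "complexity U x \<le> enat (8 * Suc l + d + c)"
      using \<open>x \<in> ?A\<close> card_d by (rule c)
    moreover have "real l \<le> log 2 (real n + 1)"
    proof -
      have "(2::real) ^ l \<le> real n + 1"
        using l(1) by (metis of_nat_1 of_nat_add of_nat_le_iff of_nat_numeral of_nat_power)
      then show ?thesis by (simp add: le_log_iff powr_realpow)
    qed
    ultimately show ?thesis
      using d(2) unfolding D_def by (intro exI[of _ "8 * Suc l + d + c"]) auto
  qed
  then show ?thesis by blast
qed

theorem theorem1:
  fixes U :: "bool list \<rightharpoonup> bool list"
  assumes "optimal U"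
  shows "\<exists>\<delta> :: real \<Rightarrow> real \<Rightarrow> real.
    (\<forall>\<alpha>\<in>{0<..<1}. \<forall>\<tau>\<in>{0<..<1}. \<delta> \<alpha> \<tau> > 0) \<and>
    (\<forall>\<alpha>\<in>{0<..<1}. \<forall>\<tau>\<in>{0<..<1}. \<forall>\<^sub>F n :: nat in sequentially.
       let \<beta> = \<alpha> + \<delta> \<alpha> \<tau> in
         \<forall>x :: bool list. length x = n \<longrightarrow>
           ereal_of_enat (complexity U x) \<ge> ereal (\<alpha> * real n) \<longrightarrow>
           measure_pmf.prob (noise \<tau> x)
             {y. ereal_of_enat (complexity U y) > ereal (\<beta> * real n)} \<ge> 1 - 1 / real n)"
proof (intro exI[of _ "\<lambda>\<alpha> \<tau>. (1 - \<alpha>) * (\<tau> * (1 - \<tau>))"] conjI ballI)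
  fix \<alpha> \<tau> :: real
  assume "\<alpha> \<in> {0<..<1}" "\<tau> \<in> {0<..<1}"
  then have \<alpha>: "0 < \<alpha>" "\<alpha> < 1" and \<tau>: "0 < \<tau>" "\<tau> < 1" by auto
  define u where "u = \<tau> * (1 - \<tau>)"
  have "0 < u" using \<tau> by (simp add: u_def)
  then show "0 < (1 - \<alpha>) * (\<tau> * (1 - \<tau>))" using \<alpha> by (simp add: u_def)
  have "0 \<le> (1 - 2 * \<tau>)\<^sup>2" by simp
  then have "u \<le> 1 / 4" by (simp add: u_def power2_eq_square algebra_simps)
  define \<beta> where "\<beta> = \<alpha> + (1 - \<alpha>) * u"
  have \<beta>: "0 < \<beta>" "\<beta> < 1"
  proof -
    show "0 < \<beta>" using \<alpha> \<open>0 < u\<close> by (simp add: \<beta>_def add_pos_pos)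
    have "(1 - \<alpha>) * u < (1 - \<alpha>) * 1" using \<alpha> \<open>u \<le> 1 / 4\<close> by (intro mult_strict_left_mono) auto
    then show "\<beta> < 1" by (simp add: \<beta>_def)
  qed
  \<comment> \<open>This is 2/p in the cardinality bound; in terms of \<open>u\<close> it is
    \<open>1 / (1 - 2 * u)\<close>.\<close>
  define s where "s = 2 / (1 + (1 - 2 * \<tau>)\<^sup>2)"
  have s: "s = 1 / (1 - 2 * u)" "0 < s" "s \<le> 2"
  proof -
    have "1 + (1 - 2 * \<tau>)\<^sup>2 = 2 * (1 - 2 * u)" by (simp add: u_def power2_eq_square algebra_simps)
    then show "s = 1 / (1 - 2 * u)" by (simp only: s_def divide_divide_eq_left[symmetric])
    then show "0 < s" "s \<le> 2" using \<open>u \<le> 1 / 4\<close> by (simp_all add: divide_le_eq)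
  qed
  define \<kappa> where "\<kappa> = (1 - \<alpha>) * u * s"
  have "0 < \<kappa>" using \<alpha> \<open>0 < u\<close> s by (simp add: \<kappa>_def)
  \<comment> \<open>The linear gain: 1 - \<beta> is \<open>(1 - \<alpha>) * (1 - u)\<close>, and
    \<open>s * (1 - u)\<close> is \<open>1 + s * u\<close>, so the coefficient of n drops below
    \<alpha> by exactly \<open>\<kappa>\<close>.\<close>
  have exponent: "1 - s + s * \<beta> = \<alpha> - \<kappa>"
  proof -
    have "1 - s + s * \<beta> - (\<alpha> - \<kappa>) = (1 - \<alpha>) * (1 - s * (1 - 2 * u))"
      unfolding \<kappa>_def \<beta>_def by (simp add: algebra_simps)
    also have "s * (1 - 2 * u) = 1" using \<open>u \<le> 1 / 4\<close> by (simp add: s(1))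
    finally show ?thesis by simp
  qed
  obtain c where c: "\<And>n m x. 0 < n \<Longrightarrow> m \<le> n \<Longrightarrow> length x = n \<Longrightarrow>
    1 / real n < measure_pmf.prob (noise \<tau> x) {y. complexity U y \<le> enat m} \<Longrightarrow>
    \<exists>K. complexity U x \<le> enat K \<and> real K \<le> real n * (1 - s) + s * (real m + 1)
      + 2 * log 2 (2 * real n * (real n + 1)) + 8 * log 2 (real n + 1) + c"
    using complexity_noise[OF assms \<tau>] unfolding s_def by blast
  \<comment> \<open>How large n must be depends on \<alpha> and \<tau> through
    \<open>\<kappa>\<close> and \<open>c\<close>, but not on the string.\<close>
  have "\<forall>\<^sub>F n in sequentially. 2 + 2 * log 2 (2 * real n * (real n + 1)) + 8 * log 2 (real n + 1) + c < \<kappa> * real n"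
    using \<open>0 < \<kappa>\<close> by real_asymp
  moreover have "\<forall>\<^sub>F n in sequentially. 0 < n" by (rule eventually_gt_at_top)
  ultimately show "\<forall>\<^sub>F n in sequentially. let \<beta> = \<alpha> + (1 - \<alpha>) * (\<tau> * (1 - \<tau>)) in
      \<forall>x. length x = n \<longrightarrow> ereal (\<alpha> * real n) \<le> ereal_of_enat (complexity U x) \<longrightarrow>
        1 - 1 / real n \<le> measure_pmf.prob (noise \<tau> x) {y. ereal (\<beta> * real n) < ereal_of_enat (complexity U y)}"
    unfolding u_def[symmetric] \<beta>_def[symmetric] Let_def
  proof eventually_elim
    case (elim n)
    show ?case
    proof (intro allI impI, rule ccontr)
      fix x :: "bool list"
      assume x: "length x = n" and complex: "ereal (\<alpha> * real n) \<le> ereal_of_enat (complexity U x)"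
        and "\<not> 1 - 1 / real n \<le> measure_pmf.prob (noise \<tau> x) {y. ereal (\<beta> * real n) < ereal_of_enat (complexity U y)}"
      define m where "m = nat \<lfloor>\<beta> * real n\<rfloor>"
      have "0 \<le> \<beta> * real n" using \<beta> by simp
      then have m: "real m \<le> \<beta> * real n" unfolding m_def by (simp add: of_nat_floor)
      have "\<beta> * real n \<le> 1 * real n" using \<beta> by (intro mult_right_mono) auto
      then have "m \<le> n" using m by linarith
      \<comment> \<open>Complexities are integers or infinite, so not exceeding
        \<open>\<beta> * real n\<close> means being at most its floor \<open>m\<close>.\<close>
      have le_m: "j \<le> m" if "real j \<le> \<beta> * real n" for j
        using that unfolding m_def by (rule le_nat_floor)
      have "ereal (\<beta> * real n) < ereal_of_enat K \<or> K \<le> enat m" for K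
        using le_m not_less by (cases K) auto
      then have "- {y. ereal (\<beta> * real n) < ereal_of_enat (complexity U y)} \<subseteq> {y. complexity U y \<le> enat m}"
        by blast
      then have "measure_pmf.prob (noise \<tau> x) (- {y. ereal (\<beta> * real n) < ereal_of_enat (complexity U y)})
          \<le> measure_pmf.prob (noise \<tau> x) {y. complexity U y \<le> enat m}"
        by (intro measure_pmf.finite_measure_mono) auto
      moreover have "measure_pmf.prob (noise \<tau> x) (- {y. ereal (\<beta> * real n) < ereal_of_enat (complexity U y)})
          = 1 - measure_pmf.prob (noise \<tau> x) {y. ereal (\<beta> * real n) < ereal_of_enat (complexity U y)}"
        using measure_pmf.prob_compl[of "{y. ereal (\<beta> * real n) < ereal_of_enat (complexity U y)}" "noise \<tau> x"]
        by (simp add: Compl_eq_Diff_UNIV)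
      ultimately have "1 / real n < measure_pmf.prob (noise \<tau> x) {y. complexity U y \<le> enat m}"
        using \<open>\<not> 1 - 1 / real n \<le> _\<close> by linarith
      then obtain K where K: "complexity U x \<le> enat K" "real K \<le> real n * (1 - s) + s * (real m + 1)
          + 2 * log 2 (2 * real n * (real n + 1)) + 8 * log 2 (real n + 1) + c"
        using c[OF elim(2) \<open>m \<le> n\<close> x] by blast
      \<comment> \<open>Since \<open>s \<le> 2\<close>, the summand 1 next to \<open>m\<close> costs
        at most the constant 2 in the asymptotic estimate.\<close>
      have "s * (real m + 1) \<le> s * (\<beta> * real n) + 2"
      proof -
        have "s * real m \<le> s * (\<beta> * real n)" using m s(2) by (intro mult_left_mono) auto
        then show ?thesis using s(3) by (simp add: distrib_left)
      qed
      then have "real K \<le> (1 - s + s * \<beta>) * real n + 2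
          + 2 * log 2 (2 * real n * (real n + 1)) + 8 * log 2 (real n + 1) + c"
        using K(2) by (simp add: algebra_simps)
      also have "\<dots> < \<alpha> * real n"
        using elim(1) unfolding exponent by (simp add: algebra_simps)
      finally have "ereal (real K) < ereal (\<alpha> * real n)" by simp
      also note complex
      also have "ereal_of_enat (complexity U x) \<le> ereal_of_enat (enat K)"
        using K(1) by (simp only: ereal_of_enat_le_iff)
      finally show False by simp
    qed
  qed
qed

end
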